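(* Let $d\ge 4$. There is a positive constant $c_d$ depending only on $d$ such that for every $f\in W_2^1(\mathbb{S}^{d-1})$ with $\int_{\mathbb{S}^{d-1}} f(x)\,d\sigma(x)=0$, $$\int_{\mathbb{S}^{d-1}} |f(x)|^2\, d\sigma(x) \le c_d \min_{e\in\mathbb{S}^{d-1}} \int_{\mathbb{S}^{d-1}} (1-\langle x,e\rangle)\, \left|(-\Delta_0)^{1/2} f(x)\right|^2 d\sigma(x).$$
   Context: $\mathbb{S}^{d-1}$ is the unit sphere of $\mathbb{R}^d$, $d\sigma$ its rotation-invariant surface measure; functions are real-valued and measurable. $\mathcal{H}_n^d$ is the space of spherical harmonics of degree $n$ (restrictions to $\mathbb{S}^{d-1}$ of homogeneous harmonic polynomials of degree $n$), and $\operatorname{proj}_n$ is the orthogonal projection of $L^2(\mathbb{S}^{d-1})$ onto $\mathcal{H}_n^d$. $\Delta_0$ is the Laplace-Beltrami operator, with $\Delta_0 Y=-n(n+d-2)Y$ for $Y\in\mathcal{H}_n^d$. For $r\in\mathbb{R}\setminus\{0\}$, $(-\Delta_0)^r$ is defined (in the distributional sense) by $\operatorname{proj}_0[(-\Delta_0)^r f]=0$ and $\operatorname{proj}_n[(-\Delta_0)^r f]=(n(n+d-2))^r\operatorname{proj}_n f$ for $n\ge1$. The Sobolev space is $W_2^\alpha(\mathbb{S}^{d-1})=\{f\in L^2(\mathbb{S}^{d-1}): (-\Delta_0)^{\alpha/2}f\in L^2(\mathbb{S}^{d-1})\}$. *)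

theory Defs
  imports "HOL-Analysis.Analysis"
begin

(* Surface measure d\<sigma> on the unit sphere in polar coordinates: \<sigma>(A) is d times the volume of
   the cone {r x | x in A, 0 < r < 1}; its total mass is the surface area of the sphere. *)
definition sphere_measure :: "'a::euclidean_space measure" where
  "sphere_measure =
     scale_measure (ennreal (real DIM('a)))
       (distr (restrict_space lborel (ball 0 1 - {0})) (restrict_space borel (sphere 0 1))
         (\<lambda>x. x /\<^sub>R norm x))"

(* The radial projection is measurable, so the distr above is not a junk value. *)
lemma emeasure_sphere_measure:
  fixes A :: "'a::euclidean_space set"
  assumes "A \<in> sets borel" "A \<subseteq> sphere 0 1"
  shows "emeasure sphere_measure A =
    ennreal (real DIM('a)) * emeasure lborel {x \<in> ball 0 1 - {0}. x /\<^sub>R norm x \<in> A}"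
proof -
  let ?D = "ball 0 1 - {0} :: 'a set"
  have m: "(\<lambda>x::'a. x /\<^sub>R norm x) \<in> restrict_space lborel ?D \<rightarrow>\<^sub>M restrict_space borel (sphere 0 1)"
    by (rule measurable_restrict_space2)
       (auto simp: space_restrict_space intro!: measurable_restrict_space1)
  have A: "A \<in> sets (restrict_space borel (sphere 0 1))"
    using assms by (subst sets_restrict_space_iff) auto
  have "(\<lambda>x. x /\<^sub>R norm x) -` A \<inter> space (restrict_space lborel ?D)
      = {x \<in> ?D. x /\<^sub>R norm x \<in> A}"
    by (auto simp: space_restrict_space)
  then show ?thesis
    unfolding sphere_measure_def emeasure_scale_measure emeasure_distr[OF m A]
    by (subst emeasure_restrict_space) auto
qed

(* Functions stand for their classes modulo equality almost everywhere. *)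
definition sphere_L2 :: "('a::euclidean_space \<Rightarrow> real) set" where
  "sphere_L2 = {f. f \<in> borel_measurable sphere_measure \<and>
                   integrable sphere_measure (\<lambda>x. (f x)\<^sup>2)}"

definition laplacian :: "('a::euclidean_space \<Rightarrow> real) \<Rightarrow> 'a \<Rightarrow> real" where
  "laplacian p x = (\<Sum>b\<in>Basis. deriv (deriv (\<lambda>t. p (x + t *\<^sub>R b))) 0)"

definition spherical_harmonics :: "nat \<Rightarrow> ('a::euclidean_space \<Rightarrow> real) set" where
  "spherical_harmonics n =
     {restrict p (sphere 0 1) | p. real_polynomial_function p \<and>
        (\<forall>t x. p (t *\<^sub>R x) = t ^ n * p x) \<and> (\<forall>x. laplacian p x = 0)}"

definition proj :: "nat \<Rightarrow> ('a::euclidean_space \<Rightarrow> real) \<Rightarrow> 'a \<Rightarrow> real" where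
  "proj n f = (THE Y. Y \<in> spherical_harmonics n \<and>
     (\<forall>Z\<in>spherical_harmonics n. (LINT x|sphere_measure. (f x - Y x) * Z x) = 0))"

(* The distribution (-\<Delta>_0)^r f is determined by its projections; this says that it is (represented
   by) the square integrable function g, which is then unique almost everywhere. *)
definition is_fractional_laplacian ::
    "real \<Rightarrow> ('a::euclidean_space \<Rightarrow> real) \<Rightarrow> ('a \<Rightarrow> real) \<Rightarrow> bool" where
  "is_fractional_laplacian r f g \<longleftrightarrow> g \<in> sphere_L2 \<and>
     (\<forall>x\<in>sphere 0 1. proj 0 g x = 0) \<and>
     (\<forall>n\<ge>1. \<forall>x\<in>sphere 0 1.
        proj n g x = (real n * (real n + real DIM('a) - 2)) powr r * proj n f x)"

definition fractional_laplacian ::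
    "real \<Rightarrow> ('a::euclidean_space \<Rightarrow> real) \<Rightarrow> 'a \<Rightarrow> real" where
  "fractional_laplacian r f = (SOME g. is_fractional_laplacian r f g)"

definition sobolev_W2 :: "real \<Rightarrow> ('a::euclidean_space \<Rightarrow> real) set" where
  "sobolev_W2 \<alpha> = {f \<in> sphere_L2. \<exists>g. is_fractional_laplacian (\<alpha> / 2) f g}"

end

theory Submission
  imports Defs "HOL-Computational_Algebra.Polynomial"
begin

text \<open>
  Write \<open>d\<close> for the dimension, \<open>w x = 1 - x \<bullet> e\<close> for the weight and \<open>g\<close> for the function
  \<open>(- \<Delta>\<^sub>0)\<^sup>1\<^sup>/\<^sup>2 f\<close>. The claim says that \<open>(- \<Delta>\<^sub>0)\<^sup>-\<^sup>1\<^sup>/\<^sup>2\<close> is bounded from the weighted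
  space with density \<open>w\<close> to the unweighted one, and by duality this is the Hardy inequality
  \<open>\<integral> h\<^sup>2 / w \<le> C \<integral> (h\<^sup>2 + |\<nabla>h|\<^sup>2)\<close> on a sphere of dimension \<open>d - 1 \<ge> 3\<close>: the weight vanishes
  quadratically at \<open>e\<close>. Any \<open>e\<close> on the sphere is admissible, so the minimum over \<open>e\<close> causes no
  further difficulty; it exists because the right-hand side is affine in \<open>e\<close>.

  The duality is carried out on polynomials only. Let \<open>Y k\<close> be the projection of \<open>f\<close> onto the
  spherical harmonics of degree \<open>k\<close> and \<open>\<lambda> k = k (k + d - 2)\<close>, so that \<open>sqrt (\<lambda> k) Y k\<close> is the
  projection of \<open>g\<close>. Put \<open>h = (\<Sum>k=1..N. Y k / sqrt (\<lambda> k))\<close> and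
  \<open>E = (\<Sum>k=1..N. \<parallel>Y k\<parallel>\<^sup>2)\<close>. Then \<open>\<langle>g, h\<rangle> = E\<close>, while \<open>\<parallel>h\<parallel>\<^sup>2 \<le> E\<close> because \<open>\<lambda> k \<ge> 1\<close>, and
  \<open>\<integral> |\<nabla>h|\<^sup>2 = E\<close> by Green's formula. With \<open>C = 2 d + 4\<close> the Hardy inequality gives
  \<open>\<integral> h\<^sup>2 / w \<le> C E\<close>, and \<open>g h \<le> C w g\<^sup>2 / 2 + h\<^sup>2 / (2 C w)\<close> integrates to
  \<open>E \<le> C \<integral> w g\<^sup>2\<close> (lemma \<open>partial_sum_bound\<close>). Throughout, \<open>w\<close> is replaced by the positive weight
  \<open>1 + s - x \<bullet> e\<close>, and \<open>s\<close> tends to \<open>0\<close> only in this final estimate, so that no singular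
  integral occurs. Since \<open>f\<close> has mean \<open>0\<close>, also \<open>Y 0 = 0\<close>, and letting \<open>N\<close> grow gives the theorem.

  All analysis on the sphere rests on one identity, the divergence theorem \<open>sphere_divergence\<close>. It
  is the infinitesimal form of the rotation invariance of the surface measure. Applied to the field
  \<open>a \<nabla>Y\<close> with \<open>Y\<close> harmonic and homogeneous it yields Green's formula and hence the orthogonality
  of harmonics of different degrees; applied to \<open>h\<^sup>2 e / w\<close> it yields the Hardy inequality.

  The remaining work concerns the expansion into spherical harmonics. A homogeneous polynomial is a
  harmonic one plus \<open>|x|\<^sup>2\<close> times another of degree smaller by two, so on the sphere every polynomial
  is a sum of harmonics. By the same decomposition, applied to monomials, the harmonics of a given
  degree are spanned by finitely many functions, so the orthogonal projections exist. Finally,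
  polynomials are dense in the square integrable functions by the Stone--Weierstrass theorem.
\<close>


section \<open>Rotation invariance of the surface measure\<close>

lemma lborel_distr_reflect: "distr lborel borel (\<lambda>y. z - y) = (lborel :: 'a::euclidean_space measure)"
  using lborel_affine[of "-1" z] by (simp add: density_1)

text \<open>
  The classical argument for uniqueness of Haar measure. Both sides equal the measure of the set of
  pairs \<open>(x, y)\<close> with \<open>R x \<in> A\<close> and \<open>R x + y \<in> B\<close>: translating \<open>y\<close> by \<open>R x\<close> gives the left-hand side;
  translating \<open>x\<close> by a preimage of \<open>y\<close> and reflecting \<open>y\<close> gives the right-hand side.
\<close>

lemma emeasure_lborel_vimage_swap:
  fixes R :: "'a::euclidean_space \<Rightarrow> 'a"
  assumes R: "orthogonal_transformation R" and [measurable]: "A \<in> sets borel" "B \<in> sets borel"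
  shows "emeasure lborel (R -` A) * emeasure lborel B = emeasure lborel (R -` B) * emeasure lborel A"
proof -
  have lin: "linear R" using R by (rule orthogonal_transformation_linear)
  have [measurable]: "R \<in> borel_measurable borel"
    using lin by (intro borel_measurable_continuous_onI linear_continuous_on linear_conv_bounded_linear[THEN iffD1])
  obtain S where S: "\<And>y. R (S y) = y"
    using orthogonal_transformation_surj[OF R] by (metis surj_f_inv_f)
  let ?a = "indicator A :: 'a \<Rightarrow> ennreal" and ?b = "indicator B :: 'a \<Rightarrow> ennreal"
  have vim: "(\<integral>\<^sup>+x. indicator C (R x) \<partial>lborel) = emeasure lborel (R -` C)" if [measurable]: "C \<in> sets borel" for C
  proof -
    have "(\<integral>\<^sup>+x. indicator C (R x) \<partial>lborel) = (\<integral>\<^sup>+x. indicator (R -` C) x \<partial>lborel)"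
      by (intro nn_integral_cong) (auto simp: indicator_def)
    also have "\<dots> = emeasure lborel (R -` C)"
      using measurable_sets_borel[of R borel C] by simp
    finally show ?thesis .
  qed
  have "emeasure lborel (R -` A) * emeasure lborel B
      = (\<integral>\<^sup>+x. ?a (R x) * (\<integral>\<^sup>+y. ?b y \<partial>lborel) \<partial>lborel)"
    by (simp add: nn_integral_multc vim)
  also have "\<dots> = (\<integral>\<^sup>+x. (\<integral>\<^sup>+y. ?a (R x) * ?b (R x + y) \<partial>lborel) \<partial>lborel)"
  proof (intro nn_integral_cong)
    fix x
    have "(\<integral>\<^sup>+y. ?b y \<partial>lborel) = (\<integral>\<^sup>+y. ?b (R x + y) \<partial>lborel)"
      by (subst lborel_distr_plus[symmetric, of "R x"], subst nn_integral_distr) auto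
    then show "?a (R x) * (\<integral>\<^sup>+y. ?b y \<partial>lborel) = (\<integral>\<^sup>+y. ?a (R x) * ?b (R x + y) \<partial>lborel)"
      by (simp add: nn_integral_cmult)
  qed
  also have "\<dots> = (\<integral>\<^sup>+y. (\<integral>\<^sup>+x. ?a (R x) * ?b (R x + y) \<partial>lborel) \<partial>lborel)"
    by (intro lborel_pair.Fubini'[symmetric]) simp
  also have "\<dots> = (\<integral>\<^sup>+y. (\<integral>\<^sup>+x. ?a (R x - y) * ?b (R x) \<partial>lborel) \<partial>lborel)"
  proof (rule nn_integral_cong)
    fix y
    have "R (- S y + x) = R x - y" for x
      using S by (simp add: linear_diff[OF lin])
    then show "(\<integral>\<^sup>+x. ?a (R x) * ?b (R x + y) \<partial>lborel) = (\<integral>\<^sup>+x. ?a (R x - y) * ?b (R x) \<partial>lborel)"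
      by (subst lborel_distr_plus[symmetric, of "- S y"], subst nn_integral_distr) auto
  qed
  also have "\<dots> = (\<integral>\<^sup>+x. (\<integral>\<^sup>+y. ?a (R x - y) * ?b (R x) \<partial>lborel) \<partial>lborel)"
    by (intro lborel_pair.Fubini') simp
  also have "\<dots> = (\<integral>\<^sup>+x. ?b (R x) * emeasure lborel A \<partial>lborel)"
  proof (intro nn_integral_cong)
    fix x
    have "emeasure lborel A = (\<integral>\<^sup>+y. ?a (R x - y) \<partial>lborel)"
      by (subst lborel_distr_reflect[symmetric, of "R x"])
         (subst nn_integral_indicator[symmetric], simp, subst nn_integral_distr, auto)
    then show "(\<integral>\<^sup>+y. ?a (R x - y) * ?b (R x) \<partial>lborel) = ?b (R x) * emeasure lborel A"
      by (subst nn_integral_multc) (auto simp: mult.commute)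
  qed
  also have "\<dots> = emeasure lborel (R -` B) * emeasure lborel A"
    by (simp add: nn_integral_multc vim)
  finally show ?thesis .
qed

text \<open>
  The unit ball is its own preimage under an orthogonal map; used as the second set in the swap
  identity, it shows that the constant relating the two translation invariant measures is \<open>1\<close>.
\<close>

lemma emeasure_lborel_orthogonal_vimage:
  fixes R :: "'a::euclidean_space \<Rightarrow> 'a"
  assumes R: "orthogonal_transformation R" and A: "A \<in> sets borel"
  shows "emeasure lborel (R -` A) = emeasure lborel A"
proof -
  have "R -` ball 0 1 = ball (0::'a) 1"
    using orthogonal_transformation_norm[OF R] by auto
  then have "emeasure lborel (R -` A) * emeasure lborel (ball 0 1 :: 'a set)
      = emeasure lborel A * emeasure lborel (ball 0 1 :: 'a set)"
    using emeasure_lborel_vimage_swap[OF R A, of "ball 0 1"] by (simp add: mult.commute)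
  moreover have "emeasure lborel (ball 0 1 :: 'a set) \<noteq> \<infinity>"
    using emeasure_bounded_finite[of "ball 0 1 :: 'a set"] by auto
  moreover have "emeasure lborel (ball 0 1 :: 'a set) \<noteq> 0"
    by (simp add: emeasure_ball less_imp_neq[OF unit_ball_vol_pos, symmetric])
  ultimately show ?thesis
    by (simp add: ennreal_mult_cancel_left mult.commute[of _ "emeasure lborel (ball 0 1)"])
qed

lemma sets_sphere_measure [measurable_cong]:
  "sets (sphere_measure :: 'a::euclidean_space measure) = sets (restrict_space borel (sphere 0 1))"
  by (simp add: sphere_measure_def)

lemma space_sphere_measure [simp]: "space (sphere_measure :: 'a::euclidean_space measure) = sphere 0 1"
  by (simp add: sphere_measure_def space_scale_measure space_restrict_space)

lemma sets_sphere_measure_iff: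
  "A \<in> sets (sphere_measure :: 'a::euclidean_space measure) \<longleftrightarrow> A \<in> sets borel \<and> A \<subseteq> sphere 0 1"
  by (auto simp: sets_sphere_measure sets_restrict_space_iff)

lemma finite_measure_sphere_measure: "finite_measure (sphere_measure :: 'a::euclidean_space measure)"
proof
  have "emeasure (sphere_measure :: 'a measure) (sphere 0 1) = ennreal (real DIM('a)) *
      emeasure lborel {x \<in> ball 0 1 - {0}. x /\<^sub>R norm x \<in> (sphere 0 1 :: 'a set)}"
    by (intro emeasure_sphere_measure) auto
  also have "\<dots> \<le> ennreal (real DIM('a)) * emeasure lborel (ball 0 1 :: 'a set)"
    by (intro mult_left_mono emeasure_mono) auto
  also have "\<dots> < \<infinity>"
    using emeasure_bounded_finite[of "ball 0 1 :: 'a set"] by (simp add: ennreal_mult_less_top)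
  finally show "emeasure (sphere_measure :: 'a measure) (space sphere_measure) \<noteq> \<infinity>" by auto
qed

interpretation sphere: finite_measure "sphere_measure :: 'a::euclidean_space measure"
  by (rule finite_measure_sphere_measure)

lemma emeasure_sphere_measure_open:
  fixes U :: "'a::euclidean_space set"
  assumes "open U" "x \<in> U" "norm x = 1"
  shows "emeasure sphere_measure (U \<inter> sphere 0 1) > 0"
proof -
  let ?C = "{x \<in> ball 0 1 - {0}. x /\<^sub>R norm x \<in> U \<inter> sphere 0 1}"
  have "?C = (\<lambda>x. x /\<^sub>R norm x) -` U \<inter> (ball 0 1 - {0})" by auto
  moreover have "open ((\<lambda>x::'a. x /\<^sub>R norm x) -` U \<inter> (ball 0 1 - {0}))"
    unfolding Int_commute[of "_ -` U"]
    by (intro continuous_open_preimage) (auto intro!: continuous_intros assms)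
  ultimately have "open ?C" by (simp)
  moreover have "x /\<^sub>R 2 \<in> ?C" using assms by auto
  then have "?C \<noteq> {}" by blast
  ultimately have "\<not> negligible ?C" by (rule open_not_negligible)
  moreover have "?C \<in> sets lborel" using \<open>open ?C\<close> by simp
  ultimately have "emeasure lborel ?C \<noteq> 0"
    unfolding negligible_iff_null_sets by (auto simp: null_sets_completionI)
  then show ?thesis
    using assms by (subst emeasure_sphere_measure) (auto simp: zero_less_iff_neq_zero)
qed

lemma orthogonal_transformation_measurable_sphere:
  assumes R: "orthogonal_transformation (R :: 'a::euclidean_space \<Rightarrow> 'a)"
  shows "R \<in> sphere_measure \<rightarrow>\<^sub>M sphere_measure"
proof -
  have "linear R" using R by (rule orthogonal_transformation_linear)
  then have "R \<in> borel_measurable borel"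
    by (intro borel_measurable_continuous_onI linear_continuous_on linear_conv_bounded_linear[THEN iffD1])
  then show ?thesis
    unfolding measurable_cong_sets[OF sets_sphere_measure sets_sphere_measure]
    using orthogonal_transformation_norm[OF R]
    by (intro measurable_restrict_space2 measurable_restrict_space1) (auto simp: space_restrict_space)
qed

text \<open>
  Orthogonal maps commute with the radial projection, so the cone over a preimage is the preimage of
  the cone.
\<close>

lemma distr_sphere_measure:
  fixes R :: "'a::euclidean_space \<Rightarrow> 'a"
  assumes R: "orthogonal_transformation R"
  shows "distr sphere_measure sphere_measure R = sphere_measure"
proof (rule measure_eqI)
  fix A assume "A \<in> sets (distr (sphere_measure :: 'a measure) sphere_measure R)"
  then have A: "A \<in> sets borel" "A \<subseteq> sphere 0 1" and A': "A \<in> sets sphere_measure"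
    by (simp_all add: sets_sphere_measure_iff)
  have Rm: "R \<in> sphere_measure \<rightarrow>\<^sub>M sphere_measure"
    by (rule orthogonal_transformation_measurable_sphere[OF R])
  have nR: "norm (R x) = norm x" for x using orthogonal_transformation_norm[OF R] .
  have lin: "linear R" using R by (rule orthogonal_transformation_linear)
  let ?C = "\<lambda>A. {x \<in> ball 0 1 - {0}. x /\<^sub>R norm x \<in> A}"
  have RA: "R -` A \<inter> sphere 0 1 \<in> sets sphere_measure"
    using measurable_sets[OF Rm A'] by simp
  have "R x = 0 \<longleftrightarrow> x = 0" for x
    using nR[of x] by (metis norm_eq_zero)
  then have "?C (R -` A \<inter> sphere 0 1) = R -` ?C A"
    using A by (auto simp: nR linear_cmul[OF lin])
  moreover have "?C A \<in> sets borel"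
  proof -
    have "?C A = (\<lambda>x. x /\<^sub>R norm x) -` A \<inter> (ball 0 1 - {0})" by auto
    moreover have "(\<lambda>x::'a. x /\<^sub>R norm x) -` A \<in> sets borel"
      by (rule measurable_sets_borel[OF _ A(1)]) simp
    ultimately show ?thesis by auto
  qed
  ultimately have "emeasure lborel (?C (R -` A \<inter> sphere 0 1)) = emeasure lborel (?C A)"
    using emeasure_lborel_orthogonal_vimage[OF R, of "?C A"] by argo
  then show "emeasure (distr sphere_measure sphere_measure R) A = emeasure sphere_measure A"
    using RA A by (simp add: emeasure_distr[OF Rm A'] sets_sphere_measure_iff emeasure_sphere_measure)
qed simp

lemma integral_sphere_orthogonal:
  fixes G :: "'a::euclidean_space \<Rightarrow> real" and R :: "'a \<Rightarrow> 'a"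
  assumes R: "orthogonal_transformation R" and G: "G \<in> borel_measurable sphere_measure"
  shows "(LINT x|sphere_measure. G (R x)) = (LINT x|sphere_measure. G x)"
  using integral_distr[OF orthogonal_transformation_measurable_sphere[OF R] G]
  by (simp add: distr_sphere_measure[OF R])

lemma borel_measurable_sphere_continuous:
  fixes G :: "'a::euclidean_space \<Rightarrow> real"
  assumes "continuous_on (sphere 0 1) G"
  shows "G \<in> borel_measurable sphere_measure"
  unfolding measurable_cong_sets[OF sets_sphere_measure refl]
  using borel_measurable_continuous_on_restrict[OF assms] .

lemma integrable_sphere_continuous:
  fixes G :: "'a::euclidean_space \<Rightarrow> real"
  assumes "continuous_on (sphere 0 1) G"
  shows "integrable sphere_measure G"
proof -
  have "bounded (G ` sphere 0 1)"
    by (intro compact_imp_bounded compact_continuous_image assms) auto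
  then obtain B where "\<And>x. x \<in> sphere 0 1 \<Longrightarrow> norm (G x) \<le> B"
    unfolding bounded_iff by blast
  then show ?thesis
    by (intro sphere.integrable_const_bound[of _ B] borel_measurable_sphere_continuous assms) auto
qed

lemma integral_sphere_cong:
  "(\<And>x. norm x = 1 \<Longrightarrow> f x = g x) \<Longrightarrow> (LINT x|sphere_measure. f x) = (LINT x|sphere_measure. g x)"
  by (rule Bochner_Integration.integral_cong) auto

lemma integral_sphere_mono:
  fixes f g :: "'a::euclidean_space \<Rightarrow> real"
  assumes "integrable sphere_measure f" "integrable sphere_measure g"
  shows "(\<And>x. norm x = 1 \<Longrightarrow> f x \<le> g x) \<Longrightarrow> (LINT x|sphere_measure. f x) \<le> (LINT x|sphere_measure. g x)"
  using assms by (intro integral_mono) auto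

lemma integral_sphere_nonneg:
  fixes f :: "'a::euclidean_space \<Rightarrow> real"
  shows "(\<And>x. norm x = 1 \<Longrightarrow> 0 \<le> f x) \<Longrightarrow> 0 \<le> (LINT x|sphere_measure. f x)"
  by (rule Bochner_Integration.integral_nonneg_AE) (auto intro: AE_I2)

text \<open>
  Nonempty open subsets of the sphere have positive measure. Consequently a polynomial orthogonal to itself vanishes pointwise there,
  not merely almost everywhere, which makes projections onto spherical harmonics unique as functions.
\<close>

lemma continuous_integral_sphere_eq_0:
  fixes G :: "'a::euclidean_space \<Rightarrow> real"
  assumes G: "continuous_on UNIV G" and nn: "\<And>x. norm x = 1 \<Longrightarrow> 0 \<le> G x"
    and 0: "(LINT x|sphere_measure. G x) = 0" and x: "norm x = 1"
  shows "G x = 0"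
proof (rule ccontr)
  assume "G x \<noteq> 0"
  with nn[OF x] have pos: "0 < G x" by auto
  have op: "open {y. 0 < G y}"
    using G by (intro open_Collect_less continuous_on_const)
  have int: "integrable sphere_measure G"
    by (intro integrable_sphere_continuous continuous_on_subset[OF G]) auto
  have "AE y in sphere_measure. 0 \<le> G y" using nn by (intro AE_I2) auto
  then have "AE y in sphere_measure. G y = 0"
    using integral_nonneg_eq_0_iff_AE[OF int] 0 by simp
  moreover have "{y. 0 < G y} \<inter> sphere 0 1 \<in> sets sphere_measure"
    using op by (simp add: sets_sphere_measure_iff)
  moreover have "{y \<in> space sphere_measure. \<not> G y = 0} = {y. 0 < G y} \<inter> sphere 0 1"
    using nn by (force simp: less_le)
  ultimately have "emeasure sphere_measure ({y. 0 < G y} \<inter> sphere 0 1) = 0"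
    using AE_iff_measurable[of "{y. 0 < G y} \<inter> sphere 0 1" sphere_measure "\<lambda>y. G y = 0"] by simp
  with emeasure_sphere_measure_open[OF op, of x] pos x show False by simp
qed

section \<open>The divergence theorem on the sphere\<close>

text \<open>
  Rotating the plane of \<open>i\<close> and \<open>j\<close> by an angle \<open>t\<close> leaves the integral of \<open>G\<close> unchanged, so its
  derivative at \<open>t = 0\<close> vanishes. The difference quotients are bounded uniformly by the mean value
  theorem and compactness, so dominated convergence moves the derivative under the integral.
\<close>

lemma integral_sphere_rotation_derivative:
  fixes G :: "'a::euclidean_space \<Rightarrow> real"
  assumes G: "\<And>x. norm x = 1 \<Longrightarrow> (G has_derivative G' x) (at x)"
    and cont: "\<And>v. continuous_on (sphere 0 1) (\<lambda>x. G' x v)"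
    and ij: "i \<in> Basis" "j \<in> Basis" "i \<noteq> j"
  shows "(LINT x|sphere_measure. G' x ((x \<bullet> i) *\<^sub>R j - (x \<bullet> j) *\<^sub>R i)) = 0"
proof -
  define D where "D x = G' x ((x \<bullet> i) *\<^sub>R j - (x \<bullet> j) *\<^sub>R i)" for x
  define R where "R t x = x + ((cos t - 1) * (x \<bullet> i) - sin t * (x \<bullet> j)) *\<^sub>R i
                            + (sin t * (x \<bullet> i) + (cos t - 1) * (x \<bullet> j)) *\<^sub>R j" for t :: real and x :: 'a
  have ip [simp]: "i \<bullet> i = 1" "j \<bullet> j = 1" "i \<bullet> j = 0" "j \<bullet> i = 0"
    using ij by (auto simp: inner_Basis)
  have Ri: "R t x \<bullet> i = cos t * (x \<bullet> i) - sin t * (x \<bullet> j)"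
    and Rj: "R t x \<bullet> j = sin t * (x \<bullet> i) + cos t * (x \<bullet> j)" for t x
    by (simp_all add: R_def inner_add_left algebra_simps)
  have orth: "orthogonal_transformation (R t)" for t
  proof -
    have "linear (R t)"
      by (rule linearI) (simp_all add: R_def inner_add_left algebra_simps)
    moreover have "R t x \<bullet> R t y = x \<bullet> y" for x y
    proof -
      have sc: "(sin t)\<^sup>2 = 1 - (cos t)\<^sup>2" by (simp add: sin_squared_eq)
      have "R t x \<bullet> R t y = R t x \<bullet> y + ((cos t - 1) * (y \<bullet> i) - sin t * (y \<bullet> j)) * (R t x \<bullet> i)
          + (sin t * (y \<bullet> i) + (cos t - 1) * (y \<bullet> j)) * (R t x \<bullet> j)"
        by (subst (2) R_def) (simp add: inner_add_right)
      also have "R t x \<bullet> y = x \<bullet> y + ((cos t - 1) * (x \<bullet> i) - sin t * (x \<bullet> j)) * (y \<bullet> i)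
                            + (sin t * (x \<bullet> i) + (cos t - 1) * (x \<bullet> j)) * (y \<bullet> j)"
        by (simp add: R_def inner_add_left inner_commute[of i y] inner_commute[of j y])
      finally show ?thesis
        unfolding Ri Rj using sc by algebra
    qed
    ultimately show ?thesis by (simp add: orthogonal_transformation_def)
  qed
  have nR: "norm (R t x) = norm x" for t x using orthogonal_transformation_norm[OF orth] .
  have R0: "R 0 x = x" for x by (simp add: R_def)
  have dR: "((\<lambda>t. R t x) has_vector_derivative (R t x \<bullet> i) *\<^sub>R j - (R t x \<bullet> j) *\<^sub>R i) (at t)" for t x
    unfolding Ri Rj unfolding R_def
    by (auto intro!: derivative_eq_intros has_vector_derivative_real_field simp: has_vector_derivative_def algebra_simps)
  have dGR: "((\<lambda>t. G (R t x)) has_real_derivative D (R t x)) (at t)" if "norm x = 1" for t x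
  proof -
    have "(G has_derivative G' (R t x)) (at (R t x))" using that by (intro G) (simp add: nR)
    from diff_chain_at[OF dR[of x t, unfolded has_vector_derivative_def] this]
    have "((\<lambda>t. G (R t x)) has_derivative (\<lambda>h. G' (R t x) (h *\<^sub>R ((R t x \<bullet> i) *\<^sub>R j - (R t x \<bullet> j) *\<^sub>R i)))) (at t)"
      by (simp add: o_def)
    moreover have "linear (G' (R t x))"
      using \<open>(G has_derivative G' (R t x)) (at (R t x))\<close> by (rule has_derivative_linear)
    ultimately show ?thesis
      by (simp add: has_field_derivative_def D_def linear_cmul mult.commute[of "G' _ _"] mult_commute_abs)
  qed
  have Dcont: "continuous_on (sphere 0 1) D"
  proof -
    have "D x = (x \<bullet> i) * G' x j - (x \<bullet> j) * G' x i" if "x \<in> sphere 0 1" for x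
      using has_derivative_linear[OF G, of x] that by (simp add: D_def linear_diff linear_cmul)
    moreover have "continuous_on (sphere 0 1) (\<lambda>x. (x \<bullet> i) * G' x j - (x \<bullet> j) * G' x i)"
      by (intro continuous_intros cont)
    ultimately show ?thesis by (metis (no_types, lifting) continuous_on_eq)
  qed
  have Gcont: "continuous_on (sphere 0 1) G"
    using G by (intro continuous_at_imp_continuous_on ballI) (auto dest: has_derivative_continuous)
  have GRcont: "continuous_on (sphere 0 1) (\<lambda>x. G (R t x))" for t
  proof -
    have "continuous_on (sphere 0 1) (R t)"
      using orthogonal_transformation_linear[OF orth] by (intro linear_continuous_on linear_conv_bounded_linear[THEN iffD1])
    moreover have "R t ` sphere 0 1 \<subseteq> sphere 0 1" by (auto simp: nR)
    ultimately show ?thesis using continuous_on_compose2[OF Gcont] by auto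
  qed
  have "bounded (D ` sphere 0 1)"
    by (intro compact_imp_bounded compact_continuous_image Dcont) auto
  then obtain B where "\<forall>x\<in>D ` sphere 0 1. norm x \<le> B" unfolding bounded_iff by blast
  then have B: "\<bar>D x\<bar> \<le> B" if "norm x = 1" for x using that by auto
  define s where "s k x = (G (R (1 / real (Suc k)) x) - G x) * real (Suc k)" for k x
  have Lip: "\<bar>G (R t x) - G x\<bar> \<le> B * t" if nx: "norm x = 1" and t: "0 < t" for x t
  proof -
    obtain z where "G (R t x) - G (R 0 x) = (t - 0) * D (R z x)"
      using MVT2[OF t, of "\<lambda>t. G (R t x)" "\<lambda>z. D (R z x)"] dGR[OF nx] by auto
    then show ?thesis
      using B[of "R z x"] nx t by (simp add: nR R0 abs_mult mult.commute)
  qed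
  have "(\<lambda>k. LINT x|sphere_measure. s k x) \<longlonglongrightarrow> (LINT x|sphere_measure. D x)"
  proof (rule integral_dominated_convergence[where w = "\<lambda>_. B"])
    show "AE x in sphere_measure. (\<lambda>k. s k x) \<longlonglongrightarrow> D x"
    proof (rule AE_I2)
      fix x :: 'a assume "x \<in> space sphere_measure"
      then have nx: "norm x = 1" by simp
      have "((\<lambda>t. (G (R (0 + t) x) - G (R 0 x)) / t) \<longlongrightarrow> D (R 0 x)) (at 0)"
        using dGR[OF nx, of 0] by (simp add: DERIV_def)
      moreover have "filterlim (\<lambda>k. 1 / real (Suc k)) (at 0) sequentially"
        unfolding filterlim_at using LIMSEQ_Suc[OF lim_1_over_n[where 'a=real]] by simp
      ultimately have "(\<lambda>k. (G (R (0 + 1 / real (Suc k)) x) - G (R 0 x)) / (1 / real (Suc k))) \<longlonglongrightarrow> D (R 0 x)"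
        by (rule filterlim_compose)
      then show "(\<lambda>k. s k x) \<longlonglongrightarrow> D x" by (simp add: s_def R0)
    qed
    show "AE x in sphere_measure. norm (s k x) \<le> B" for k
    proof (rule AE_I2)
      fix x :: 'a assume "x \<in> space sphere_measure"
      then have nx: "norm x = 1" by simp
      have "\<bar>s k x\<bar> = \<bar>G (R (1 / real (Suc k)) x) - G x\<bar> * real (Suc k)"
        by (simp add: s_def abs_mult)
      also have "\<dots> \<le> (B * (1 / real (Suc k))) * real (Suc k)"
        by (intro mult_right_mono Lip nx) auto
      finally show "norm (s k x) \<le> B" by simp
    qed
    show "s k \<in> borel_measurable sphere_measure" for k
      unfolding s_def by (intro borel_measurable_sphere_continuous continuous_intros Gcont GRcont)
    show "D \<in> borel_measurable sphere_measure"
      by (intro borel_measurable_sphere_continuous Dcont)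
  qed simp
  moreover have "(LINT x|sphere_measure. s k x) = 0" for k
    using integral_sphere_orthogonal[OF orth, of G "1 / real (Suc k)"]
    by (simp add: s_def integrable_sphere_continuous GRcont Gcont borel_measurable_sphere_continuous)
  ultimately show ?thesis
    by (simp add: D_def LIMSEQ_const_iff)
qed

text \<open>
  The integrand is the tangential divergence of \<open>V\<close> minus the contribution \<open>(d - 1) V x \<bullet> x\<close> of the
  mean curvature. It arises by applying the rotation derivative in the plane of \<open>i\<close> and \<open>j\<close> to the
  function \<open>(x \<bullet> i) (V x \<bullet> j)\<close> and summing over all \<open>i \<noteq> j\<close>.
\<close>

theorem sphere_divergence:
  fixes V :: "'a::euclidean_space \<Rightarrow> 'a"
  assumes V: "\<And>x. norm x = 1 \<Longrightarrow> (V has_derivative V' x) (at x)"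
    and cont: "\<And>v. continuous_on (sphere 0 1) (\<lambda>x. V' x v)"
  shows "(LINT x|sphere_measure. (\<Sum>b\<in>Basis. V' x b \<bullet> b) - V' x x \<bullet> x - (DIM('a) - 1) * (V x \<bullet> x)) = 0"
proof -
  define E where "E i j x = (x \<bullet> i)\<^sup>2 * (V' x j \<bullet> j) - (x \<bullet> i) * (x \<bullet> j) * (V' x i \<bullet> j)
      - (if i = j then 0 else (x \<bullet> j) * (V x \<bullet> j))" for i j x
  have Vcont: "continuous_on (sphere 0 1) V"
    using V by (intro continuous_at_imp_continuous_on ballI) (auto dest: has_derivative_continuous)
  have Econt: "continuous_on (sphere 0 1) (E i j)" for i j
    unfolding E_def by (cases "i = j") (auto intro!: continuous_intros cont Vcont)
  have E0: "(LINT x|sphere_measure. E i j x) = 0" if ij: "i \<in> Basis" "j \<in> Basis" for i j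
  proof (cases "i = j")
    case True
    then show ?thesis by (simp add: E_def power2_eq_square)
  next
    case False
    let ?G' = "\<lambda>x v. (x \<bullet> i) * (V' x v \<bullet> j) + (v \<bullet> i) * (V x \<bullet> j)"
    have "(LINT x|sphere_measure. ?G' x ((x \<bullet> i) *\<^sub>R j - (x \<bullet> j) *\<^sub>R i)) = 0"
    proof (rule integral_sphere_rotation_derivative[OF _ _ ij False])
      show "((\<lambda>x. (x \<bullet> i) * (V x \<bullet> j)) has_derivative ?G' x) (at x)" if "norm x = 1" for x
        using V[OF that] by (auto intro!: derivative_eq_intros)
    qed (intro continuous_intros cont Vcont)
    also have "(LINT x|sphere_measure. ?G' x ((x \<bullet> i) *\<^sub>R j - (x \<bullet> j) *\<^sub>R i)) = (LINT x|sphere_measure. E i j x)"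
    proof (rule integral_sphere_cong)
      fix x :: 'a assume "norm x = 1"
      then have "linear (V' x)" using V has_derivative_linear by blast
      then show "?G' x ((x \<bullet> i) *\<^sub>R j - (x \<bullet> j) *\<^sub>R i) = E i j x"
        using ij False by (simp add: E_def linear_diff linear_cmul inner_diff_left inner_Basis algebra_simps power2_eq_square)
    qed
    finally show ?thesis .
  qed
  have "(LINT x|sphere_measure. (\<Sum>i\<in>Basis. \<Sum>j\<in>Basis. E i j x)) = 0"
    using Econt by (simp add: integrable_sphere_continuous E0)
  also have "(LINT x|sphere_measure. (\<Sum>i\<in>Basis. \<Sum>j\<in>Basis. E i j x)) =
     (LINT x|sphere_measure. (\<Sum>b\<in>Basis. V' x b \<bullet> b) - V' x x \<bullet> x - (DIM('a) - 1) * (V x \<bullet> x))"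
  proof (rule integral_sphere_cong)
    fix x :: 'a assume nx: "norm x = 1"
    then have lin: "linear (V' x)" using V has_derivative_linear by blast
    have 1: "(\<Sum>i\<in>Basis. \<Sum>j\<in>Basis. (x \<bullet> i)\<^sup>2 * (V' x j \<bullet> j)) = (\<Sum>b\<in>Basis. V' x b \<bullet> b)"
    proof -
      have "(\<Sum>i\<in>Basis. (x \<bullet> i)\<^sup>2) = 1"
        using nx euclidean_inner[of x x] by (simp add: power2_eq_square norm_eq_1)
      then show ?thesis by (simp flip: sum_distrib_left sum_distrib_right)
    qed
    have 2: "(\<Sum>i\<in>Basis. \<Sum>j\<in>Basis. (x \<bullet> i) * (x \<bullet> j) * (V' x i \<bullet> j)) = V' x x \<bullet> x"
    proof -
      have "V' x x = V' x (\<Sum>i\<in>Basis. (x \<bullet> i) *\<^sub>R i)" by (simp add: euclidean_representation)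
      also have "\<dots> = (\<Sum>i\<in>Basis. (x \<bullet> i) *\<^sub>R V' x i)"
        by (simp add: linear_sum[OF lin] linear_cmul[OF lin])
      finally have "V' x x \<bullet> x = (\<Sum>i\<in>Basis. (x \<bullet> i) * (V' x i \<bullet> x))"
        by (simp add: inner_sum_left)
      also have "\<dots> = (\<Sum>i\<in>Basis. (x \<bullet> i) * (\<Sum>j\<in>Basis. (V' x i \<bullet> j) * (x \<bullet> j)))"
        by (simp flip: euclidean_inner)
      finally show ?thesis by (simp add: sum_distrib_left ac_simps)
    qed
    have 3: "(\<Sum>i\<in>Basis. \<Sum>j\<in>Basis. if i = j then 0 else (x \<bullet> j) * (V x \<bullet> j)) = (DIM('a) - 1) * (V x \<bullet> x)"
    proof -
      have "(\<Sum>j\<in>Basis. if i = j then 0 else (x \<bullet> j) * (V x \<bullet> j)) = V x \<bullet> x - (x \<bullet> i) * (V x \<bullet> i)"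
        if "i \<in> Basis" for i
      proof -
        have "(\<Sum>j\<in>Basis. if i = j then 0 else (x \<bullet> j) * (V x \<bullet> j)) =
          (\<Sum>j\<in>Basis. (x \<bullet> j) * (V x \<bullet> j) - (if i = j then (x \<bullet> j) * (V x \<bullet> j) else 0))"
          by (intro sum.cong) auto
        then show ?thesis using that
          by (simp add: sum_subtractf sum.delta' euclidean_inner[of "V x" x] mult.commute)
      qed
      then show ?thesis
        by (simp add: sum_subtractf of_nat_diff left_diff_distrib euclidean_inner[of "V x" x] mult.commute Suc_leI)
    qed
    show "(\<Sum>i\<in>Basis. \<Sum>j\<in>Basis. E i j x) = (\<Sum>b\<in>Basis. V' x b \<bullet> b) - V' x x \<bullet> x - (DIM('a) - 1) * (V x \<bullet> x)"
      unfolding E_def sum_subtractf 1 2 3 ..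
  qed
  finally show ?thesis .
qed

section \<open>Gradients of polynomials, Green's formula and the Hardy inequality\<close>

definition grad :: "('a::euclidean_space \<Rightarrow> real) \<Rightarrow> 'a \<Rightarrow> 'a" where
  "grad p x = (THE a. GDERIV p x :> a)"

lemma grad_eqI: "GDERIV p x :> a \<Longrightarrow> grad p x = a"
  unfolding grad_def gderiv_def
proof (rule the_equality)
  fix b assume "(p has_derivative (\<lambda>h. h \<bullet> a)) (at x)" "(p has_derivative (\<lambda>h. h \<bullet> b)) (at x)"
  then have "(\<lambda>h. h \<bullet> a) = (\<lambda>h. h \<bullet> b)" by (rule has_derivative_unique)
  then show "b = a" by (metis inner_commute vector_eq_rdot)
qed

lemma polynomial_gradient_exists:
  fixes p :: "'a::euclidean_space \<Rightarrow> real"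
  assumes "real_polynomial_function p"
  shows "\<exists>g. polynomial_function g \<and> (\<forall>x. GDERIV p x :> g x)"
  using assms
proof induction
  case (linear f)
  have "f v = v \<bullet> (\<Sum>b\<in>Basis. f b *\<^sub>R b)" for v
    using Linear_Algebra.linear_componentwise[OF bounded_linear.linear[OF linear], of v 1]
    by (simp add: inner_sum_right mult.commute)
  then have "f = (\<lambda>v. v \<bullet> (\<Sum>b\<in>Basis. f b *\<^sub>R b))" by (rule ext)
  then have "GDERIV f x :> (\<Sum>b\<in>Basis. f b *\<^sub>R b)" for x
    unfolding gderiv_def using bounded_linear_imp_has_derivative[OF linear, of "at x"] by simp
  then show ?case by (intro exI[of _ "\<lambda>_. \<Sum>b\<in>Basis. f b *\<^sub>R b"]) simp
next
  case (const c)
  show ?case by (intro exI[of _ "\<lambda>_. 0"]) (simp add: GDERIV_const)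
next
  case (add f g)
  then obtain f' g' where "polynomial_function f'" "\<And>x. GDERIV f x :> f' x"
    "polynomial_function g'" "\<And>x. GDERIV g x :> g' x" by blast
  then show ?case
    by (intro exI[of _ "\<lambda>x. f' x + g' x"]) (auto intro!: GDERIV_add)
next
  case (mult f g)
  then obtain f' g' where "polynomial_function f'" "\<And>x. GDERIV f x :> f' x"
    "polynomial_function g'" "\<And>x. GDERIV g x :> g' x" by blast
  with mult show ?case
    by (intro exI[of _ "\<lambda>x. f x *\<^sub>R g' x + g x *\<^sub>R f' x"])
       (auto simp: real_polynomial_function_eq intro!: GDERIV_mult)
qed

lemma GDERIV_grad: "real_polynomial_function p \<Longrightarrow> GDERIV p x :> grad p x"
proof -
  assume "real_polynomial_function p"
  then obtain a where "GDERIV p x :> a" using polynomial_gradient_exists by blast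
  with grad_eqI[OF this] show ?thesis by simp
qed

lemma polynomial_grad: "real_polynomial_function p \<Longrightarrow> polynomial_function (grad p)"
proof -
  assume "real_polynomial_function p"
  then obtain g where g: "polynomial_function g" "\<And>x. GDERIV p x :> g x"
    using polynomial_gradient_exists by blast
  then have "grad p = g" by (auto simp: grad_eqI)
  with g show ?thesis by simp
qed

lemma real_polynomial_grad: "real_polynomial_function p \<Longrightarrow> real_polynomial_function (\<lambda>x. grad p x \<bullet> b)"
  using polynomial_grad bounded_linear_inner_left[of b] unfolding polynomial_function_def o_def by blast

lemma real_polynomial_inner: "real_polynomial_function (\<lambda>x. x \<bullet> b)"
  using bounded_linear_inner_left by (rule real_polynomial_function.intros)

lemma continuous_on_polynomial: "real_polynomial_function p \<Longrightarrow> continuous_on S p"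
  using continuous_on_polymonial_function real_polynomial_function_eq by blast

lemma continuous_on_grad: "real_polynomial_function p \<Longrightarrow> continuous_on S (grad p)"
  using continuous_on_polymonial_function polynomial_grad by blast

lemma integrable_sphere_polynomial: "real_polynomial_function p \<Longrightarrow> integrable sphere_measure p"
  by (intro integrable_sphere_continuous continuous_on_polynomial)

lemma has_derivative_grad: "real_polynomial_function p \<Longrightarrow> (p has_derivative (\<lambda>v. v \<bullet> grad p x)) (at x)"
  using GDERIV_grad by (simp add: gderiv_def)

lemma deriv_line:
  assumes "real_polynomial_function p"
  shows "((\<lambda>t. p (x + t *\<^sub>R b)) has_real_derivative grad p (x + t *\<^sub>R b) \<bullet> b) (at t)"
proof -
  have "((\<lambda>t. x + t *\<^sub>R b) has_derivative (\<lambda>h. h *\<^sub>R b)) (at t)"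
    by (auto intro!: derivative_eq_intros)
  from diff_chain_at[OF this has_derivative_grad[OF assms]] show ?thesis
    by (simp add: has_field_derivative_def o_def inner_commute mult.commute mult_commute_abs)
qed

definition hessian :: "('a::euclidean_space \<Rightarrow> real) \<Rightarrow> 'a \<Rightarrow> 'a \<Rightarrow> 'a" where
  "hessian p x v = (\<Sum>b\<in>Basis. (v \<bullet> grad (\<lambda>y. grad p y \<bullet> b) x) *\<^sub>R b)"

lemma has_derivative_hessian:
  assumes "real_polynomial_function p"
  shows "(grad p has_derivative hessian p x) (at x)"
proof -
  have "((\<lambda>y. \<Sum>b\<in>Basis. (grad p y \<bullet> b) *\<^sub>R b) has_derivative hessian p x) (at x)"
    unfolding hessian_def
    by (intro has_derivative_sum has_derivative_scaleR_left has_derivative_grad real_polynomial_grad assms)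
  then show ?thesis by (simp add: euclidean_representation)
qed

lemma continuous_on_hessian:
  assumes "real_polynomial_function p"
  shows "continuous_on S (\<lambda>x. hessian p x v)"
  unfolding hessian_def by (intro continuous_intros continuous_on_grad real_polynomial_grad assms)

lemma laplacian_eq:
  assumes "real_polynomial_function p"
  shows "laplacian p x = (\<Sum>b\<in>Basis. grad (\<lambda>y. grad p y \<bullet> b) x \<bullet> b)"
  unfolding laplacian_def
proof (rule sum.cong[OF refl])
  fix b :: 'a
  have "deriv (\<lambda>t. p (x + t *\<^sub>R b)) = (\<lambda>t. grad p (x + t *\<^sub>R b) \<bullet> b)"
    using DERIV_imp_deriv[OF deriv_line[OF assms]] by auto
  then show "deriv (deriv (\<lambda>t. p (x + t *\<^sub>R b))) 0 = grad (\<lambda>y. grad p y \<bullet> b) x \<bullet> b"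
    using DERIV_imp_deriv[OF deriv_line[OF real_polynomial_grad[OF assms], of x b b 0]] by simp
qed

lemma laplacian_hessian:
  assumes "real_polynomial_function p"
  shows "laplacian p x = (\<Sum>b\<in>Basis. hessian p x b \<bullet> b)"
  unfolding laplacian_eq[OF assms]
proof (rule sum.cong[OF refl])
  fix b :: 'a assume b: "b \<in> Basis"
  have "hessian p x b \<bullet> b = (\<Sum>c\<in>Basis. if c = b then b \<bullet> grad (\<lambda>y. grad p y \<bullet> c) x else 0)"
    unfolding hessian_def inner_sum_left using b by (intro sum.cong) (auto simp: inner_Basis)
  then show "grad (\<lambda>y. grad p y \<bullet> b) x \<bullet> b = hessian p x b \<bullet> b"
    using b by (simp add: inner_commute)
qed

definition homogeneous_polys :: "nat \<Rightarrow> ('a::euclidean_space \<Rightarrow> real) set" where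
  "homogeneous_polys n = {p. real_polynomial_function p \<and> (\<forall>t x. p (t *\<^sub>R x) = t ^ n * p x)}"

definition harmonic_polys :: "nat \<Rightarrow> ('a::euclidean_space \<Rightarrow> real) set" where
  "harmonic_polys n = {p \<in> homogeneous_polys n. \<forall>x. laplacian p x = 0}"

lemma homogeneous_polys_polynomial: "p \<in> homogeneous_polys n \<Longrightarrow> real_polynomial_function p" by (simp add: homogeneous_polys_def)
lemma harmonic_polys_homogeneous_polys: "p \<in> harmonic_polys n \<Longrightarrow> p \<in> homogeneous_polys n" by (simp add: harmonic_polys_def)
lemma harmonic_polys_polynomial: "p \<in> harmonic_polys n \<Longrightarrow> real_polynomial_function p" by (simp add: harmonic_polys_def homogeneous_polys_def)

lemma euler_grad:
  assumes "p \<in> homogeneous_polys n"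
  shows "grad p x \<bullet> x = real n * p x"
proof -
  have "((\<lambda>t. p (0 + t *\<^sub>R x)) has_real_derivative grad p (0 + 1 *\<^sub>R x) \<bullet> x) (at 1)"
    by (rule deriv_line[OF homogeneous_polys_polynomial[OF assms]])
  moreover have "(\<lambda>t. p (0 + t *\<^sub>R x)) = (\<lambda>t. t ^ n * p x)"
    using assms by (simp add: homogeneous_polys_def)
  moreover have "((\<lambda>t. t ^ n * p x) has_real_derivative real n * p x) (at 1)"
    by (auto intro!: derivative_eq_intros)
  ultimately show ?thesis using DERIV_unique by fastforce
qed

text \<open>
  Obtained by differentiating Euler's identity for the gradient in the direction \<open>x\<close>.
\<close>

lemma euler_hessian:
  assumes p: "p \<in> homogeneous_polys n"
  shows "hessian p x x \<bullet> x = (real n - 1) * real n * p x"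
proof -
  have "((\<lambda>y. grad p y \<bullet> y) has_derivative (\<lambda>v. grad p x \<bullet> v + hessian p x v \<bullet> x)) (at x)"
    by (intro has_derivative_inner has_derivative_hessian has_derivative_ident homogeneous_polys_polynomial[OF p])
  moreover have "((\<lambda>y. real n * p y) has_derivative (\<lambda>v. real n * (v \<bullet> grad p x))) (at x)"
    by (intro has_derivative_mult_right has_derivative_grad homogeneous_polys_polynomial[OF p])
  ultimately have "(\<lambda>v. grad p x \<bullet> v + hessian p x v \<bullet> x) = (\<lambda>v. real n * (v \<bullet> grad p x))"
    unfolding euler_grad[OF p] by (rule has_derivative_unique)
  then have "grad p x \<bullet> x + hessian p x x \<bullet> x = real n * (x \<bullet> grad p x)" by metis
  then show ?thesis by (simp add: inner_commute[of x] euler_grad[OF p] algebra_simps)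
qed

text \<open>
  On the unit sphere this is the inner product of the components of the two gradients tangential to the
  sphere, so that \<open>tangential h h\<close> is the squared length of the intrinsic gradient of \<open>h\<close>.
\<close>

definition tangential :: "('a::euclidean_space \<Rightarrow> real) \<Rightarrow> ('a \<Rightarrow> real) \<Rightarrow> 'a \<Rightarrow> real" where
  "tangential p q x = grad p x \<bullet> grad q x - (grad p x \<bullet> x) * (grad q x \<bullet> x)"

lemma tangential_commute: "tangential p q x = tangential q p x"
  by (simp add: tangential_def inner_commute mult.commute)

lemma continuous_on_tangential:
  "real_polynomial_function p \<Longrightarrow> real_polynomial_function q \<Longrightarrow> continuous_on S (tangential p q)"
  unfolding tangential_def by (intro continuous_intros continuous_on_grad)

text \<open>
  The divergence theorem for the field \<open>a \<nabla>Y\<close>. As \<open>Y\<close> is harmonic, only first derivatives of \<open>a\<close> and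
  \<open>Y\<close> and the radial derivatives of \<open>Y\<close> remain, and Euler's identities turn the latter into the
  eigenvalue.
\<close>

lemma green_harmonic:
  fixes Y :: "'a::euclidean_space \<Rightarrow> real"
  assumes Y: "Y \<in> harmonic_polys n" and a: "real_polynomial_function a"
  shows "(LINT x|sphere_measure. tangential a Y x)
    = real n * (real n + real DIM('a) - 2) * (LINT x|sphere_measure. a x * Y x)"
proof -
  have Yp: "real_polynomial_function Y" and Yh: "Y \<in> homogeneous_polys n" using Y by (auto simp: harmonic_polys_def homogeneous_polys_def)
  let ?V' = "\<lambda>x v. a x *\<^sub>R hessian Y x v + (v \<bullet> grad a x) *\<^sub>R grad Y x"
  let ?l = "real n * (real n + real DIM('a) - 2)"
  have "(LINT x|sphere_measure. (\<Sum>b\<in>Basis. ?V' x b \<bullet> b) - ?V' x x \<bullet> x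
      - (DIM('a) - 1) * ((a x *\<^sub>R grad Y x) \<bullet> x)) = 0"
  proof (rule sphere_divergence)
    show "((\<lambda>x. a x *\<^sub>R grad Y x) has_derivative ?V' x) (at x)" for x
      by (rule has_derivative_scaleR[OF has_derivative_grad[OF a] has_derivative_hessian[OF Yp]])
    show "continuous_on (sphere 0 1) (\<lambda>x. ?V' x v)" for v
      by (intro continuous_on_add continuous_on_scaleR continuous_on_inner continuous_on_const
          continuous_on_grad continuous_on_hessian continuous_on_polynomial a Yp)
  qed
  also have "(LINT x|sphere_measure. (\<Sum>b\<in>Basis. ?V' x b \<bullet> b) - ?V' x x \<bullet> x
      - (DIM('a) - 1) * ((a x *\<^sub>R grad Y x) \<bullet> x))
    = (LINT x|sphere_measure. tangential a Y x - ?l * (a x * Y x))"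
  proof (rule integral_sphere_cong)
    fix x :: 'a
    have "(\<Sum>b\<in>Basis. ?V' x b \<bullet> b) = a x * laplacian Y x + grad a x \<bullet> grad Y x"
      unfolding laplacian_hessian[OF Yp] euclidean_inner[of "grad a x" "grad Y x"]
      by (simp add: inner_add_left sum.distrib sum_distrib_left inner_commute[of _ "grad a x"])
    also have "\<dots> = grad a x \<bullet> grad Y x" using Y by (simp add: harmonic_polys_def)
    finally show "(\<Sum>b\<in>Basis. ?V' x b \<bullet> b) - ?V' x x \<bullet> x - (DIM('a) - 1) * ((a x *\<^sub>R grad Y x) \<bullet> x)
        = tangential a Y x - ?l * (a x * Y x)"
      by (simp add: tangential_def inner_add_left euler_hessian[OF Yh] euler_grad[OF Yh] inner_commute[of x]
          of_nat_diff Suc_leI algebra_simps)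
  qed
  also have "\<dots> = (LINT x|sphere_measure. tangential a Y x) - ?l * (LINT x|sphere_measure. a x * Y x)"
  proof -
    have "integrable sphere_measure (\<lambda>x. tangential a Y x)"
      by (intro integrable_sphere_continuous continuous_on_tangential a Yp)
    moreover have "integrable sphere_measure (\<lambda>x. a x * Y x)"
      by (intro integrable_sphere_polynomial real_polynomial_function.intros a Yp)
    ultimately show ?thesis by simp
  qed
  finally show ?thesis by simp
qed

text \<open>
  The left-hand side of Green's formula is symmetric in the two functions, while the eigenvalues
  differ.
\<close>

lemma harmonic_polys_orthogonal:
  fixes Y Z :: "'a::euclidean_space \<Rightarrow> real"
  assumes "Y \<in> harmonic_polys n" "Z \<in> harmonic_polys m" "n \<noteq> m" "DIM('a) \<ge> 2"
  shows "(LINT x|sphere_measure. Y x * Z x) = 0"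
proof -
  have "(LINT x|sphere_measure. tangential Y Z x) = (LINT x|sphere_measure. tangential Z Y x)"
    by (subst tangential_commute) simp
  then have eq: "real m * (real m + real DIM('a) - 2) * (LINT x|sphere_measure. Y x * Z x)
      = real n * (real n + real DIM('a) - 2) * (LINT x|sphere_measure. Y x * Z x)"
    using green_harmonic[OF assms(1) harmonic_polys_polynomial[OF assms(2)]] green_harmonic[OF assms(2) harmonic_polys_polynomial[OF assms(1)]]
    by (simp add: mult.commute[of "Z _"])
  have "(real m - real n) * (real m + real n + (real DIM('a) - 2)) =
    real m * (real m + real DIM('a) - 2) - real n * (real n + real DIM('a) - 2)" by (simp add: algebra_simps)
  then have "(real m - real n) * (real m + real n + (real DIM('a) - 2)) * (LINT x|sphere_measure. Y x * Z x) = 0"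
    using eq by (simp only: left_diff_distrib)
  moreover have "real m + real n + (real DIM('a) - 2) > 0" using assms(3,4) by linarith
  ultimately show ?thesis using assms(3) by auto
qed

text \<open>
  The pointwise comparison behind the Hardy inequality: the last bracket is the integrand of the
  divergence theorem for the field \<open>h\<^sup>2 e / w\<close>, where \<open>u = x \<bullet> e\<close> and \<open>m = d - 1\<close>, and \<open>G\<close> and \<open>T\<close> stand
  for \<open>|\<nabla>h|\<^sup>2\<close> and \<open>\<nabla>h \<bullet> \<nabla>u\<close> with tangential gradients.
  The main term of the bracket is \<open>- (m - 2) h\<^sup>2 / w\<close> up to \<open>(m - 1) h\<^sup>2\<close>; half of \<open>h\<^sup>2 / w\<close> is given
  away to absorb the mixed term \<open>2 h T / w\<close>, and \<open>m \<ge> 3\<close> is what leaves the other half.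
\<close>

lemma hardy_pointwise:
  fixes h G T u w m :: real
  assumes w: "0 < w" "1 - u \<le> w" and u: "u \<le> 1" "-1 \<le> u"
    and T: "T\<^sup>2 \<le> G * (1 - u\<^sup>2)" and G: "0 \<le> G" and m: "3 \<le> m"
  shows "h\<^sup>2 / w \<le> 2 * ((m - 1) * h\<^sup>2 + 4 * G - (2 * h * T / w + h\<^sup>2 * (1 - u\<^sup>2) / w\<^sup>2 - m * (h\<^sup>2 * u / w)))"
proof -
  have fac: "1 - u\<^sup>2 = (1 + u) * (1 - u)" by algebra
  have *: "(1 - u\<^sup>2) / w \<le> 1 + u"
    unfolding fac pos_divide_le_eq[OF w(1)] using w u by (intro mult_left_mono) auto
  have cap: "(1 - u\<^sup>2) / w \<le> 2" "(1 - u\<^sup>2) / w\<^sup>2 \<le> (1 + u) / w"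
    using * u divide_right_mono[OF *, of w] w(1) by (auto simp: power2_eq_square)
  have "2 * h * T \<le> h\<^sup>2 / 2 + 2 * T\<^sup>2"
    using zero_le_power2[of "h - 2 * T"] by (simp add: power2_diff power_mult_distrib)
  then have "2 * h * T / w \<le> (h\<^sup>2 / 2 + 2 * T\<^sup>2) / w"
    using w(1) by (intro divide_right_mono) auto
  also have "\<dots> = h\<^sup>2 / w / 2 + 2 * (T\<^sup>2 / w)" by (simp add: add_divide_distrib)
  also have "T\<^sup>2 / w \<le> G * ((1 - u\<^sup>2) / w)"
    using T w(1) divide_right_mono[OF T, of w] by simp
  also have "\<dots> \<le> G * 2" using cap(1) G by (rule mult_left_mono)
  finally have 1: "2 * h * T / w \<le> h\<^sup>2 / w / 2 + 4 * G" by simp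
  have 2: "h\<^sup>2 * (1 - u\<^sup>2) / w\<^sup>2 \<le> h\<^sup>2 / w * (1 + u)"
    using mult_left_mono[OF cap(2), of "h\<^sup>2"] by simp
  have "(2 + u - m * u) \<le> (m - 1) * (1 - u)" using m by (simp add: algebra_simps)
  also have "\<dots> \<le> (m - 1) * w" using m w by (intro mult_left_mono) auto
  finally have "h\<^sup>2 / w * (2 + u - m * u) \<le> h\<^sup>2 / w * ((m - 1) * w)"
    using w(1) by (intro mult_left_mono) auto
  also have "\<dots> = (m - 1) * h\<^sup>2" using w(1) by simp
  finally have 3: "h\<^sup>2 / w * (2 + u - m * u) \<le> (m - 1) * h\<^sup>2" .
  have 4: "m * (h\<^sup>2 * u / w) = h\<^sup>2 / w * (m * u)" by simp
  have "h\<^sup>2 * (1 - u\<^sup>2) / w\<^sup>2 \<le> h\<^sup>2 / w + h\<^sup>2 / w * u"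
    "2 * (h\<^sup>2 / w) + h\<^sup>2 / w * u - h\<^sup>2 / w * (m * u) \<le> (m - 1) * h\<^sup>2"
  proof -
    have "A * (1 + u) = A + A * u" "A * (2 + u - m * u) = 2 * A + A * u - A * (m * u)" for A :: real
      by (simp_all add: algebra_simps)
    with 2 3 show "h\<^sup>2 * (1 - u\<^sup>2) / w\<^sup>2 \<le> h\<^sup>2 / w + h\<^sup>2 / w * u"
      "2 * (h\<^sup>2 / w) + h\<^sup>2 / w * u - h\<^sup>2 / w * (m * u) \<le> (m - 1) * h\<^sup>2" by metis+
  qed
  moreover have "A \<le> 2 * (M + 4 * G - (X + Z - Q))" if "X \<le> A / 2 + 4 * G" "Z \<le> A + P" "2 * A + P - Q \<le> M"
    for A M X Z P Q :: real using that by argo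
  ultimately show ?thesis using 1 unfolding 4 by blast
qed

lemma grad_inner_const: "grad (\<lambda>x. x \<bullet> e) x = e"
  by (rule grad_eqI) (simp add: gderiv_def bounded_linear_imp_has_derivative bounded_linear_inner_left)

lemma tangential_cauchy_schwarz:
  assumes x: "norm x = 1"
  shows "(tangential p q x)\<^sup>2 \<le> tangential p p x * tangential q q x" "0 \<le> tangential p p x"
proof -
  have xx: "x \<bullet> x = 1" using x by (simp add: norm_eq_1)
  define a where "a r = grad r x - (grad r x \<bullet> x) *\<^sub>R x" for r
  have "tangential r s x = a r \<bullet> a s" for r s
    by (simp add: tangential_def a_def inner_diff_left inner_diff_right xx
        inner_commute[of x "grad r x"] inner_commute[of x "grad s x"])
  then show "(tangential p q x)\<^sup>2 \<le> tangential p p x * tangential q q x" "0 \<le> tangential p p x"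
    by (simp_all add: Cauchy_Schwarz_ineq)
qed

text \<open>
  Integrating the pointwise comparison, the divergence term drops out. The shift \<open>s\<close> makes the weight
  positive on the sphere; since the constants do not depend on \<open>s\<close>, nothing is lost.
\<close>

theorem sphere_hardy:
  fixes h :: "'a::euclidean_space \<Rightarrow> real"
  assumes h: "real_polynomial_function h" and e: "norm e = 1" and s: "0 < s" and d: "DIM('a) \<ge> 4"
  shows "(LINT x|sphere_measure. (h x)\<^sup>2 / (1 + s - x \<bullet> e))
     \<le> 2 * ((DIM('a) - 2) * (LINT x|sphere_measure. (h x)\<^sup>2) + 4 * (LINT x|sphere_measure. tangential h h x))"
proof -
  have ux: "\<bar>x \<bullet> e\<bar> \<le> 1" if "norm x = 1" for x
    using Cauchy_Schwarz_ineq2[of x e] that e by simp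
  have wpos: "1 + s - x \<bullet> e > 0" if "norm x = 1" for x using ux[OF that] s by linarith
  let ?w = "\<lambda>x. 1 + s - x \<bullet> e"
  let ?f = "\<lambda>x. (h x)\<^sup>2 / ?w x"
  let ?f' = "\<lambda>x v. (2 * h x * (v \<bullet> grad h x)) / ?w x + (h x)\<^sup>2 * (v \<bullet> e) / (?w x)\<^sup>2"
  let ?T = "\<lambda>x. tangential h (\<lambda>x. x \<bullet> e) x"
  let ?B = "\<lambda>x. 2 * h x * ?T x / ?w x + (h x)\<^sup>2 * (1 - (x \<bullet> e)\<^sup>2) / (?w x)\<^sup>2
              - (DIM('a) - 1) * ((h x)\<^sup>2 * (x \<bullet> e) / ?w x)"
  have wc: "continuous_on (sphere 0 1) ?w" by (intro continuous_intros)
  have w0: "\<forall>x\<in>sphere 0 1. ?w x \<noteq> 0" "\<forall>x\<in>sphere 0 1. (?w x)\<^sup>2 \<noteq> 0"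
    using wpos by force+
  have hc: "continuous_on (sphere 0 1) h" by (rule continuous_on_polynomial[OF h])
  have div0: "(LINT x|sphere_measure. (\<Sum>b\<in>Basis. (?f' x b *\<^sub>R e) \<bullet> b) - (?f' x x *\<^sub>R e) \<bullet> x
          - (DIM('a) - 1) * ((?f x *\<^sub>R e) \<bullet> x)) = 0"
  proof (rule sphere_divergence)
    fix x :: 'a assume x: "norm x = 1"
    \<comment> \<open>The quotient rule, with \<open>- c\<close> standing for the derivative of the weight.\<close>
    have quot: "(a * w - b * (- c)) / (w * w) = a / w + b * c / w\<^sup>2" if "w > 0" for a b c w :: real
      using that by (simp add: field_simps power2_eq_square)
    have "((\<lambda>x. (h x)\<^sup>2) has_derivative (\<lambda>v. 2 * h x * (v \<bullet> grad h x))) (at x)"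
      by (auto intro!: derivative_eq_intros has_derivative_grad[OF h])
    moreover have "(?w has_derivative (\<lambda>v. - (v \<bullet> e))) (at x)"
      by (auto intro!: derivative_eq_intros)
    ultimately have "(?f has_derivative (\<lambda>v. (2 * h x * (v \<bullet> grad h x) * ?w x - (h x)\<^sup>2 * (- (v \<bullet> e))) / (?w x * ?w x))) (at x)"
      using wpos[OF x] by (intro has_derivative_divide') auto
    then have "(?f has_derivative ?f' x) (at x)"
      unfolding quot[OF wpos[OF x]] .
    then show "((\<lambda>x. ?f x *\<^sub>R e) has_derivative (\<lambda>v. ?f' x v *\<^sub>R e)) (at x)"
      by (rule has_derivative_scaleR_left)
  next
    fix v
    show "continuous_on (sphere 0 1) (\<lambda>x. ?f' x v *\<^sub>R e)"
      by (intro continuous_intros hc continuous_on_grad h w0)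
  qed
  have collect: "(2 * h * a / w + h\<^sup>2 / w\<^sup>2) - ((2 * h * b) / w + h\<^sup>2 * u / w\<^sup>2) * u - D * (h\<^sup>2 / w * u)
      = 2 * h * (a - b * u) / w + h\<^sup>2 * (1 - u\<^sup>2) / w\<^sup>2 - D * (h\<^sup>2 * u / w)" for h a b u w D :: real
    by (simp add: divide_inverse power2_eq_square algebra_simps)
  note div0
  also have "(LINT x|sphere_measure. (\<Sum>b\<in>Basis. (?f' x b *\<^sub>R e) \<bullet> b) - (?f' x x *\<^sub>R e) \<bullet> x
          - (DIM('a) - 1) * ((?f x *\<^sub>R e) \<bullet> x)) = (LINT x|sphere_measure. ?B x)"
  proof (rule integral_sphere_cong)
    fix x :: 'a
    have ee: "e \<bullet> e = 1" using e by (simp add: norm_eq_1)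
    have "(?f' x b *\<^sub>R e) \<bullet> b = 2 * h x / ?w x * ((grad h x \<bullet> b) * (e \<bullet> b))
        + (h x)\<^sup>2 / (?w x)\<^sup>2 * ((e \<bullet> b) * (e \<bullet> b))" for b
      unfolding inner_commute[of b] inner_scaleR_left by (simp add: distrib_right)
    then have "(\<Sum>b\<in>Basis. (?f' x b *\<^sub>R e) \<bullet> b)
        = 2 * h x / ?w x * (\<Sum>b\<in>Basis. (grad h x \<bullet> b) * (e \<bullet> b))
        + (h x)\<^sup>2 / (?w x)\<^sup>2 * (\<Sum>b\<in>Basis. (e \<bullet> b) * (e \<bullet> b))"
      by (simp only: sum.distrib sum_distrib_left)
    also have "\<dots> = 2 * h x * (grad h x \<bullet> e) / ?w x + (h x)\<^sup>2 / (?w x)\<^sup>2"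
      unfolding euclidean_inner[symmetric] ee by simp
    finally show "(\<Sum>b\<in>Basis. (?f' x b *\<^sub>R e) \<bullet> b) - (?f' x x *\<^sub>R e) \<bullet> x
          - (DIM('a) - 1) * ((?f x *\<^sub>R e) \<bullet> x) = ?B x"
      unfolding tangential_def grad_inner_const inner_scaleR_left inner_commute[of e x] inner_commute[of x "grad h x"]
      by (simp only: collect)
  qed
  finally have B0: "(LINT x|sphere_measure. ?B x) = 0" .
  have Bc: "continuous_on (sphere 0 1) ?B"
    by (intro continuous_intros hc continuous_on_tangential h real_polynomial_inner w0)
  have Gc: "continuous_on (sphere 0 1) (\<lambda>x. tangential h h x)"
    by (intro continuous_on_tangential h)
  have int: "integrable sphere_measure ?B" "integrable sphere_measure (\<lambda>x. (h x)\<^sup>2)"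
    "integrable sphere_measure (\<lambda>x. tangential h h x)" "integrable sphere_measure ?f"
    by (intro integrable_sphere_continuous Bc Gc continuous_intros hc w0)+
  have "(LINT x|sphere_measure. ?f x)
      \<le> (LINT x|sphere_measure. 2 * ((DIM('a) - 2) * (h x)\<^sup>2 + 4 * tangential h h x - ?B x))"
  proof (rule integral_sphere_mono)
    fix x :: 'a assume x: "norm x = 1"
    have "tangential (\<lambda>x. x \<bullet> e) (\<lambda>x. x \<bullet> e) x = 1 - (x \<bullet> e)\<^sup>2"
      using e by (simp add: tangential_def grad_inner_const norm_eq_1 inner_commute power2_eq_square)
    then have "?f x \<le> 2 * ((real (DIM('a) - 1) - 1) * (h x)\<^sup>2 + 4 * tangential h h x - ?B x)"
      using tangential_cauchy_schwarz(1)[OF x, of h "\<lambda>x. x \<bullet> e"] tangential_cauchy_schwarz(2)[OF x, of h]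
        ux[OF x] s wpos[OF x] d
      by (intro hardy_pointwise) auto
    then show "?f x \<le> 2 * ((DIM('a) - 2) * (h x)\<^sup>2 + 4 * tangential h h x - ?B x)"
      using d by (simp add: of_nat_diff)
  next
    have "integrable sphere_measure (\<lambda>x. 2 * (c * F x + 4 * G x - B x))"
      if "integrable sphere_measure F" "integrable sphere_measure G" "integrable sphere_measure B"
      for F G B :: "'a \<Rightarrow> real" and c using that by simp
    from this[OF int(2,3,1)]
    show "integrable sphere_measure (\<lambda>x. 2 * ((DIM('a) - 2) * (h x)\<^sup>2 + 4 * tangential h h x - ?B x))" .
  qed (rule int(4))
  also have "\<dots> = 2 * ((DIM('a) - 2) * (LINT x|sphere_measure. (h x)\<^sup>2)
      + 4 * (LINT x|sphere_measure. tangential h h x) - (LINT x|sphere_measure. ?B x))"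
  proof -
    have "(LINT x|sphere_measure. 2 * (c * F x + 4 * G x - B x))
      = 2 * (c * (LINT x|sphere_measure. F x) + 4 * (LINT x|sphere_measure. G x) - (LINT x|sphere_measure. B x))"
      if "integrable sphere_measure F" "integrable sphere_measure G" "integrable sphere_measure B"
      for F G B :: "'a \<Rightarrow> real" and c using that by simp
    from this[OF int(2,3,1)] show ?thesis .
  qed
  finally show ?thesis using B0 by simp
qed

section \<open>Harmonic decomposition of homogeneous polynomials\<close>

lemma homogeneous_polysI: "real_polynomial_function p \<Longrightarrow> (\<And>t x. p (t *\<^sub>R x) = t ^ n * p x) \<Longrightarrow> p \<in> homogeneous_polys n"
  by (simp add: homogeneous_polys_def)

lemma homogeneous_polysD: "p \<in> homogeneous_polys n \<Longrightarrow> p (t *\<^sub>R x) = t ^ n * p x"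
  by (simp add: homogeneous_polys_def)

lemma homogeneous_polys_zero: "(\<lambda>x. 0) \<in> homogeneous_polys n"
  by (auto simp: homogeneous_polys_def)

lemma homogeneous_polys_add: "p \<in> homogeneous_polys n \<Longrightarrow> q \<in> homogeneous_polys n \<Longrightarrow> (\<lambda>x. p x + q x) \<in> homogeneous_polys n"
  by (auto simp: homogeneous_polys_def algebra_simps)

lemma homogeneous_polys_scale: "p \<in> homogeneous_polys n \<Longrightarrow> (\<lambda>x. c * p x) \<in> homogeneous_polys n"
  by (auto simp: homogeneous_polys_def)

lemma homogeneous_polys_mult: "p \<in> homogeneous_polys n \<Longrightarrow> q \<in> homogeneous_polys m \<Longrightarrow> (\<lambda>x. p x * q x) \<in> homogeneous_polys (n + m)"
  by (auto simp: homogeneous_polys_def power_add)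

lemma homogeneous_polys_sum: "finite A \<Longrightarrow> (\<And>i. i \<in> A \<Longrightarrow> p i \<in> homogeneous_polys n) \<Longrightarrow> (\<lambda>x. \<Sum>i\<in>A. p i x) \<in> homogeneous_polys n"
  by (induction A rule: finite_induct) (auto intro: homogeneous_polys_zero homogeneous_polys_add)

lemma polynomial_norm_sq: "real_polynomial_function (\<lambda>x::'a::euclidean_space. x \<bullet> x)"
  unfolding euclidean_inner[of "x" "x" for x :: 'a]
  by (intro real_polynomial_function_sum real_polynomial_function.intros real_polynomial_inner finite_Basis)

lemma norm_sq_homogeneous_polys: "(\<lambda>x. x \<bullet> x) \<in> homogeneous_polys 2"
  by (intro homogeneous_polysI polynomial_norm_sq) (simp add: power2_eq_square)

lemma grad_add:
  "real_polynomial_function p \<Longrightarrow> real_polynomial_function q \<Longrightarrow> grad (\<lambda>x. p x + q x) x = grad p x + grad q x"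
  by (intro grad_eqI GDERIV_add GDERIV_grad)

lemma grad_mult:
  "real_polynomial_function p \<Longrightarrow> real_polynomial_function q
    \<Longrightarrow> grad (\<lambda>x. p x * q x) x = p x *\<^sub>R grad q x + q x *\<^sub>R grad p x"
  by (intro grad_eqI GDERIV_mult GDERIV_grad)

lemma grad_const: "grad (\<lambda>x. c) x = 0"
  by (intro grad_eqI GDERIV_const)

lemma grad_scale: "real_polynomial_function p \<Longrightarrow> grad (\<lambda>x. c * p x) x = c *\<^sub>R grad p x"
  by (subst grad_mult) (auto simp: grad_const)

lemma grad_norm_sq: "grad (\<lambda>x. x \<bullet> x) x = 2 *\<^sub>R x"
proof (rule grad_eqI)
  have "((\<lambda>x. x \<bullet> x) has_derivative (\<lambda>v. x \<bullet> v + v \<bullet> x)) (at x)"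
    by (intro has_derivative_inner has_derivative_ident)
  then show "GDERIV (\<lambda>x. x \<bullet> x) x :> 2 *\<^sub>R x"
    by (simp add: gderiv_def inner_commute[of x])
qed

lemma laplacian_add:
  assumes "real_polynomial_function p" "real_polynomial_function q"
  shows "laplacian (\<lambda>x. p x + q x) x = laplacian p x + laplacian q x"
  unfolding laplacian_eq[OF real_polynomial_function.intros(3)[OF assms]] laplacian_eq[OF assms(1)] laplacian_eq[OF assms(2)]
    grad_add[OF assms] inner_add_left grad_add[OF real_polynomial_grad[OF assms(1)] real_polynomial_grad[OF assms(2)]]
  by (rule sum.distrib)

lemma laplacian_scale:
  assumes "real_polynomial_function p"
  shows "laplacian (\<lambda>x. c * p x) x = c * laplacian p x"
  unfolding laplacian_eq[OF real_polynomial_function.intros(4)[OF real_polynomial_function.intros(2) assms]] laplacian_eq[OF assms]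
    grad_scale[OF assms] inner_scaleR_left grad_scale[OF real_polynomial_grad[OF assms]]
  by (simp add: sum_distrib_left)

lemma laplacian_norm_sq_mult:
  fixes q :: "'a::euclidean_space \<Rightarrow> real"
  assumes q: "q \<in> homogeneous_polys k"
  shows "laplacian (\<lambda>x. (x \<bullet> x) * q x) x = (2 * DIM('a) + 4 * k) * q x + (x \<bullet> x) * laplacian q x"
proof -
  have rq: "real_polynomial_function q" by (rule homogeneous_polys_polynomial[OF q])
  note polys = real_polynomial_function.intros(2-) polynomial_norm_sq rq real_polynomial_inner real_polynomial_grad
  let ?p = "\<lambda>x. (x \<bullet> x) * q x"
  have 1: "grad ?p y \<bullet> b = (y \<bullet> y) * (grad q y \<bullet> b) + 2 * (q y * (y \<bullet> b))" for y b
    by (subst grad_mult) (auto simp: polynomial_norm_sq rq grad_norm_sq inner_add_left)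
  have 2: "grad (\<lambda>y. (y \<bullet> y) * (grad q y \<bullet> b) + 2 * (q y * (y \<bullet> b))) x \<bullet> b
      = (x \<bullet> x) * (grad (\<lambda>y. grad q y \<bullet> b) x \<bullet> b) + 4 * ((grad q x \<bullet> b) * (x \<bullet> b)) + 2 * q x"
    if b: "b \<in> Basis" for b
  proof -
    have "grad (\<lambda>y. (y \<bullet> y) * (grad q y \<bullet> b) + 2 * (q y * (y \<bullet> b))) x
      = grad (\<lambda>y. (y \<bullet> y) * (grad q y \<bullet> b)) x + grad (\<lambda>y. 2 * (q y * (y \<bullet> b))) x"
      by (rule grad_add) (intro polys)+
    also have "grad (\<lambda>y. (y \<bullet> y) * (grad q y \<bullet> b)) x
      = (x \<bullet> x) *\<^sub>R grad (\<lambda>y. grad q y \<bullet> b) x + (grad q x \<bullet> b) *\<^sub>R (2 *\<^sub>R x)"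
      by (subst grad_mult) (auto simp: grad_norm_sq polynomial_norm_sq real_polynomial_grad rq)
    also have "grad (\<lambda>y. 2 * (q y * (y \<bullet> b))) x = 2 *\<^sub>R grad (\<lambda>y. q y * (y \<bullet> b)) x"
      by (rule grad_scale) (intro polys)
    also have "grad (\<lambda>y. q y * (y \<bullet> b)) x = q x *\<^sub>R b + (x \<bullet> b) *\<^sub>R grad q x"
      by (subst grad_mult) (auto simp: grad_inner_const rq real_polynomial_inner)
    finally show ?thesis using b by (simp add: inner_add_left algebra_simps)
  qed
  have "laplacian ?p x = (\<Sum>b\<in>Basis. grad (\<lambda>y. grad ?p y \<bullet> b) x \<bullet> b)"
    by (rule laplacian_eq) (intro polys)
  also have "\<dots> = (x \<bullet> x) * laplacian q x + 4 * (\<Sum>b\<in>Basis. (grad q x \<bullet> b) * (x \<bullet> b)) + 2 * DIM('a) * q x"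
    by (simp add: 1 2 sum.distrib laplacian_eq[OF rq] sum_distrib_left)
  also have "(\<Sum>b\<in>Basis. (grad q x \<bullet> b) * (x \<bullet> b)) = k * q x"
    unfolding euclidean_inner[symmetric] by (rule euler_grad[OF q])
  finally show ?thesis by (simp add: algebra_simps)
qed

lemma norm_sq_power_mult_homogeneous_polys: "q \<in> homogeneous_polys k \<Longrightarrow> (\<lambda>x. (x \<bullet> x) ^ j * q x) \<in> homogeneous_polys (k + 2 * j)"
proof (induction j)
  case (Suc j)
  from homogeneous_polys_mult[OF norm_sq_homogeneous_polys Suc.IH[OF Suc.prems]] show ?case by (simp add: mult.assoc)
qed simp

lemma laplacian_norm_sq_power:
  fixes q :: "'a::euclidean_space \<Rightarrow> real"
  assumes q: "q \<in> homogeneous_polys k"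
  shows "laplacian (\<lambda>x. (x \<bullet> x) ^ Suc j * q x) x
    = 2 * (j + 1) * (2 * j + DIM('a) + 2 * k) * ((x \<bullet> x) ^ j * q x) + (x \<bullet> x) ^ Suc j * laplacian q x"
proof (induction j)
  case 0
  then show ?case using laplacian_norm_sq_mult[OF q, of x] by simp
next
  case (Suc j)
  have "laplacian (\<lambda>x. (x \<bullet> x) ^ Suc (Suc j) * q x) x
    = laplacian (\<lambda>x. (x \<bullet> x) * ((x \<bullet> x) ^ Suc j * q x)) x" by (simp add: mult.assoc)
  also have "\<dots> = (2 * DIM('a) + 4 * (k + 2 * Suc j)) * ((x \<bullet> x) ^ Suc j * q x)
      + (x \<bullet> x) * laplacian (\<lambda>x. (x \<bullet> x) ^ Suc j * q x) x"
    by (rule laplacian_norm_sq_mult[OF norm_sq_power_mult_homogeneous_polys[OF q]])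
  finally show ?case unfolding Suc by (simp add: algebra_simps)
qed

text \<open>
  Dividing by \<open>t\<close>, as one does to compute the degree of a derivative, loses the value \<open>t = 0\<close>;
  continuity restores it.
\<close>

lemma homogeneous_polys_extend_zero:
  fixes q :: "'a::euclidean_space \<Rightarrow> real"
  assumes q: "real_polynomial_function q" and h: "\<And>t x. t \<noteq> 0 \<Longrightarrow> q (t *\<^sub>R x) = t ^ n * q x"
  shows "q \<in> homogeneous_polys n"
proof (rule homogeneous_polysI[OF q])
  fix t :: real and x :: 'a
  show "q (t *\<^sub>R x) = t ^ n * q x"
  proof (cases "t = 0")
    case True
    have "continuous_on UNIV (\<lambda>t. q (t *\<^sub>R x))"
      by (rule continuous_on_compose2[OF continuous_on_polynomial[OF q, of UNIV]]) (auto intro!: continuous_intros)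
    then have "((\<lambda>t. q (t *\<^sub>R x)) \<longlongrightarrow> q (0 *\<^sub>R x)) (at 0)"
      by (simp only: continuous_on_eq_continuous_at[OF open_UNIV] isCont_def ball_UNIV)
    moreover have "((\<lambda>t. t ^ n * q x) \<longlongrightarrow> 0 ^ n * q x) (at 0)"
      by (intro tendsto_intros)
    then have "((\<lambda>t. q (t *\<^sub>R x)) \<longlongrightarrow> 0 ^ n * q x) (at 0)"
      by (rule Lim_transform_eventually) (auto simp: eventually_at_filter h)
    ultimately have "q (0 *\<^sub>R x) = 0 ^ n * q x"
      by (rule tendsto_unique[rotated]) simp
    then show ?thesis using True by simp
  qed (rule h)
qed

lemma grad_homogeneous_polys:
  fixes p :: "'a::euclidean_space \<Rightarrow> real"
  assumes p: "p \<in> homogeneous_polys (Suc n)"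
  shows "(\<lambda>x. grad p x \<bullet> b) \<in> homogeneous_polys n"
proof (rule homogeneous_polys_extend_zero)
  fix t :: real and x :: 'a assume t: "t \<noteq> 0"
  have "((\<lambda>s. p (t *\<^sub>R x + s *\<^sub>R (t *\<^sub>R b))) has_real_derivative grad p (t *\<^sub>R x + 0 *\<^sub>R (t *\<^sub>R b)) \<bullet> (t *\<^sub>R b)) (at 0)"
    by (rule deriv_line[OF homogeneous_polys_polynomial[OF p]])
  moreover have "(\<lambda>s. p (t *\<^sub>R x + s *\<^sub>R (t *\<^sub>R b))) = (\<lambda>s. t ^ Suc n * p (x + s *\<^sub>R b))"
  proof
    fix s
    have "t *\<^sub>R x + s *\<^sub>R (t *\<^sub>R b) = t *\<^sub>R (x + s *\<^sub>R b)" by (simp add: scaleR_add_right mult.commute)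
    then show "p (t *\<^sub>R x + s *\<^sub>R (t *\<^sub>R b)) = t ^ Suc n * p (x + s *\<^sub>R b)"
      using homogeneous_polysD[OF p, of t "x + s *\<^sub>R b"] by simp
  qed
  moreover have "((\<lambda>s. t ^ Suc n * p (x + s *\<^sub>R b)) has_real_derivative t ^ Suc n * (grad p (x + 0 *\<^sub>R b) \<bullet> b)) (at 0)"
    by (intro DERIV_cmult deriv_line[OF homogeneous_polys_polynomial[OF p]])
  ultimately have "grad p (t *\<^sub>R x) \<bullet> (t *\<^sub>R b) = t ^ Suc n * (grad p x \<bullet> b)"
    using DERIV_unique by fastforce
  with t show "grad p (t *\<^sub>R x) \<bullet> b = t ^ n * (grad p x \<bullet> b)" by simp
qed (rule real_polynomial_grad[OF homogeneous_polys_polynomial[OF p]])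

text \<open>
  The case \<open>t = 0\<close> of homogeneity, with \<open>0 ^ 0 = 1\<close>.
\<close>

lemma homogeneous_polys_0_const: "p \<in> homogeneous_polys 0 \<Longrightarrow> p x = p 0"
  using homogeneous_polysD[of p 0 0 x] by simp

lemma grad_homogeneous_polys_0: assumes "p \<in> homogeneous_polys 0" shows "grad p x = 0"
proof -
  have "p = (\<lambda>x. p 0)" using homogeneous_polys_0_const[OF assms] by blast
  then show ?thesis using grad_const by metis
qed

lemma laplacian_homogeneous_polys:
  assumes p: "p \<in> homogeneous_polys (Suc (Suc n))"
  shows "laplacian p \<in> homogeneous_polys n"
proof -
  have "laplacian p = (\<lambda>x. \<Sum>b\<in>Basis. grad (\<lambda>y. grad p y \<bullet> b) x \<bullet> b)"
    using laplacian_eq[OF homogeneous_polys_polynomial[OF p]] by auto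
  then show ?thesis using p by (simp add: homogeneous_polys_sum grad_homogeneous_polys)
qed

lemma laplacian_low_degree:
  fixes p :: "'a::euclidean_space \<Rightarrow> real"
  assumes p: "p \<in> homogeneous_polys n" and n: "n < 2"
  shows "laplacian p x = 0"
proof -
  have "grad (\<lambda>y. grad p y \<bullet> b) x = 0" for b
  proof (cases n)
    case 0
    then have "grad p y = 0" for y using grad_homogeneous_polys_0 p by blast
    then show ?thesis by (simp add: grad_const)
  next
    case (Suc m)
    with n have "m = 0" by simp
    with Suc p have "(\<lambda>y. grad p y \<bullet> b) \<in> homogeneous_polys 0" using grad_homogeneous_polys by blast
    then show ?thesis by (rule grad_homogeneous_polys_0)
  qed
  then show ?thesis by (simp add: laplacian_eq[OF homogeneous_polys_polynomial[OF p]])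
qed

text \<open>
  Multiplying by \<open>|x|\<^sup>2\<close> and then applying the Laplacian is surjective on homogeneous polynomials. On
  \<open>|x|\<^sup>2\<^sup>j q\<close> it acts as multiplication by a positive constant, up to an error of the form
  \<open>|x|\<^sup>2\<^sup>j\<^sup>+\<^sup>2 \<Delta>q\<close> in which the degree of the second factor has dropped by two. This explains the
  parameter \<open>j\<close> and the induction on \<open>k\<close>.
\<close>

lemma laplacian_norm_sq_surj:
  fixes q :: "'a::euclidean_space \<Rightarrow> real"
  assumes "q \<in> homogeneous_polys k"
  shows "\<exists>r\<in>homogeneous_polys (k + 2 * j). \<forall>x. laplacian (\<lambda>x. (x \<bullet> x) * r x) x = (x \<bullet> x) ^ j * q x"
  using assms
proof (induction k arbitrary: j q rule: less_induct)
  case (less k)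
  note q = less.prems
  define a where "a = real (2 * (j + 1) * (2 * j + DIM('a) + 2 * k))"
  have a: "a \<noteq> 0" unfolding a_def of_nat_eq_0_iff by simp
  define s where "s x = (x \<bullet> x) ^ j * q x" for x
  have s: "s \<in> homogeneous_polys (k + 2 * j)" unfolding s_def by (rule norm_sq_power_mult_homogeneous_polys[OF q])
  have Ls: "laplacian (\<lambda>x. (x \<bullet> x) * s x) x = a * s x + (x \<bullet> x) ^ Suc j * laplacian q x" for x
    using laplacian_norm_sq_power[OF q, of j x] by (simp add: s_def a_def mult.assoc)
  obtain t where t: "t \<in> homogeneous_polys (k + 2 * j)"
    and Lt: "\<And>x. laplacian (\<lambda>x. (x \<bullet> x) * t x) x = (x \<bullet> x) ^ Suc j * laplacian q x"
  proof (cases "k < 2")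
    case True
    then have "laplacian q x = 0" for x using laplacian_low_degree[OF q] by simp
    moreover have "laplacian (\<lambda>x. (x \<bullet> x) * 0) x = 0" for x :: 'a
      using laplacian_low_degree[OF homogeneous_polys_zero[of 0]] by simp
    ultimately show ?thesis using that[OF homogeneous_polys_zero] by simp
  next
    case False
    then obtain m where m: "k = Suc (Suc m)" by (metis add_2_eq_Suc not_less le_Suc_ex)
    then have "laplacian q \<in> homogeneous_polys m" using q laplacian_homogeneous_polys by blast
    from less.IH[OF _ this, of "Suc j"] show ?thesis
      using that m by auto
  qed
  note rp = homogeneous_polys_polynomial[OF s] homogeneous_polys_polynomial[OF t] polynomial_norm_sq
  let ?r = "\<lambda>x. (1 / a) * (s x + (-1) * t x)"
  have "laplacian (\<lambda>x. (x \<bullet> x) * ?r x) x = s x" for x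
  proof -
    have "(\<lambda>x. (x \<bullet> x) * ?r x) = (\<lambda>x. (1 / a) * ((x \<bullet> x) * s x + (-1) * ((x \<bullet> x) * t x)))"
      by (simp add: algebra_simps)
    moreover have "laplacian \<dots> x = (1 / a) * (laplacian (\<lambda>x. (x \<bullet> x) * s x) x + (-1) * laplacian (\<lambda>x. (x \<bullet> x) * t x) x)"
      by (subst laplacian_scale laplacian_add | intro real_polynomial_function.intros(2-) rp)+ simp
    ultimately show ?thesis unfolding Ls Lt using a by (simp add: field_simps)
  qed
  moreover have "?r \<in> homogeneous_polys (k + 2 * j)" by (intro homogeneous_polys_scale homogeneous_polys_add s t)
  ultimately show ?case unfolding s_def by (intro bexI[of _ ?r] allI) (simp_all only: s_def)
qed

lemma harmonic_polys_zero: "(\<lambda>x. 0) \<in> harmonic_polys n"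
  by (simp add: harmonic_polys_def homogeneous_polys_zero laplacian_low_degree[OF homogeneous_polys_zero[of 0]])

lemma harmonic_polys_add: "p \<in> harmonic_polys n \<Longrightarrow> q \<in> harmonic_polys n \<Longrightarrow> (\<lambda>x. p x + q x) \<in> harmonic_polys n"
  using laplacian_add[OF harmonic_polys_polynomial harmonic_polys_polynomial, of p n q n] by (simp add: harmonic_polys_def homogeneous_polys_add)

lemma harmonic_polys_scale: "p \<in> harmonic_polys n \<Longrightarrow> (\<lambda>x. c * p x) \<in> harmonic_polys n"
  using laplacian_scale[OF harmonic_polys_polynomial, of p n c] by (simp add: harmonic_polys_def homogeneous_polys_scale)

lemma homogeneous_polys_low_harmonic_polys: "p \<in> homogeneous_polys n \<Longrightarrow> n < 2 \<Longrightarrow> p \<in> harmonic_polys n"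
  by (simp add: harmonic_polys_def laplacian_low_degree)

text \<open>
  The summand \<open>r\<close> is chosen such that \<open>\<Delta>(|x|\<^sup>2 r) = \<Delta>p\<close>.
\<close>

lemma harmonic_decomposition:
  fixes p :: "'a::euclidean_space \<Rightarrow> real"
  assumes p: "p \<in> homogeneous_polys (Suc (Suc n))"
  shows "\<exists>Y\<in>harmonic_polys (Suc (Suc n)). \<exists>r\<in>homogeneous_polys n. \<forall>x. p x = Y x + (x \<bullet> x) * r x"
proof -
  obtain r where r: "r \<in> homogeneous_polys n" and L: "\<And>x. laplacian (\<lambda>x. (x \<bullet> x) * r x) x = laplacian p x"
    using laplacian_norm_sq_surj[OF laplacian_homogeneous_polys[OF p], of 0] by auto
  have xr: "(\<lambda>x. (x \<bullet> x) * r x) \<in> homogeneous_polys (Suc (Suc n))"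
    using homogeneous_polys_mult[OF norm_sq_homogeneous_polys r] by simp
  have "(\<lambda>x. p x + (-1) * ((x \<bullet> x) * r x)) \<in> harmonic_polys (Suc (Suc n))"
    unfolding harmonic_polys_def
    using homogeneous_polys_add[OF p homogeneous_polys_scale[OF xr, of "-1"]] laplacian_add[OF homogeneous_polys_polynomial[OF p] homogeneous_polys_polynomial[OF homogeneous_polys_scale[OF xr, of "-1"]]]
      laplacian_scale[OF homogeneous_polys_polynomial[OF xr], of "-1"] L by simp
  then show ?thesis using r by (intro bexI[of _ "\<lambda>x. p x + (-1) * ((x \<bullet> x) * r x)"] bexI[of _ r]) auto
qed

lemma homogeneous_polys_sum_harmonic_polys:
  fixes p :: "'a::euclidean_space \<Rightarrow> real"
  assumes "p \<in> homogeneous_polys n"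
  shows "\<exists>Z. (\<forall>k. Z k \<in> harmonic_polys k) \<and> (\<forall>x. norm x = 1 \<longrightarrow> p x = (\<Sum>k\<le>n. Z k x))"
  using assms
proof (induction n arbitrary: p rule: less_induct)
  case (less n)
  show ?case
  proof (cases "n < 2")
    case True
    let ?Z = "\<lambda>k. if k = n then p else (\<lambda>x. 0)"
    have "(\<Sum>k\<le>n. ?Z k x) = p x" for x
      by (simp add: if_distrib[of "\<lambda>f. f x"] cong: if_cong)
    then show ?thesis using homogeneous_polys_low_harmonic_polys[OF less.prems True]
      by (intro exI[of _ ?Z]) (auto simp: harmonic_polys_zero)
  next
    case False
    then obtain m where m: "n = Suc (Suc m)" by (metis add_2_eq_Suc not_less le_Suc_ex)
    with less.prems obtain Y r where Y: "Y \<in> harmonic_polys n" and r: "r \<in> homogeneous_polys m" and p: "\<And>x. p x = Y x + (x \<bullet> x) * r x"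
      using harmonic_decomposition by metis
    from less.IH[OF _ r] m obtain Z where Z: "\<And>k. Z k \<in> harmonic_polys k" "\<And>x. norm x = 1 \<Longrightarrow> r x = (\<Sum>k\<le>m. Z k x)"
      by auto
    let ?Z = "\<lambda>k. if k = n then Y else if k \<le> m then Z k else (\<lambda>x. 0)"
    have "p x = (\<Sum>k\<le>n. ?Z k x)" if "norm x = 1" for x
    proof -
      have "(\<Sum>k\<le>n. ?Z k x) = (\<Sum>k\<le>m. ?Z k x) + Y x" using m by simp
      also have "(\<Sum>k\<le>m. ?Z k x) = (\<Sum>k\<le>m. Z k x)" using m by (intro sum.cong) auto
      finally show ?thesis using p[of x] Z(2)[OF that] that by (simp add: norm_eq_1)
    qed
    then show ?thesis using Y Z by (intro exI[of _ ?Z]) (auto simp: harmonic_polys_zero)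
  qed
qed

section \<open>Homogeneous polynomials form finite-dimensional spaces\<close>

text \<open>
  The linear span, as an inductive set: each use is an induction along the linear combination, and
  coefficients never enter.
\<close>

inductive_set fun_span :: "('a \<Rightarrow> real) set \<Rightarrow> ('a \<Rightarrow> real) set" for S where
  zero: "(\<lambda>x. 0) \<in> fun_span S"
| base: "s \<in> S \<Longrightarrow> s \<in> fun_span S"
| add: "f \<in> fun_span S \<Longrightarrow> g \<in> fun_span S \<Longrightarrow> (\<lambda>x. f x + g x) \<in> fun_span S"
| scale: "f \<in> fun_span S \<Longrightarrow> (\<lambda>x. c * f x) \<in> fun_span S"

lemma fun_span_mono: "S \<subseteq> T \<Longrightarrow> f \<in> fun_span S \<Longrightarrow> f \<in> fun_span T"
proof -
  assume ST: "S \<subseteq> T"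
  show "f \<in> fun_span S \<Longrightarrow> f \<in> fun_span T"
    by (induction rule: fun_span.induct) (use ST in \<open>auto intro: fun_span.intros\<close>)
qed

lemma fun_span_sum: "finite A \<Longrightarrow> (\<And>i. i \<in> A \<Longrightarrow> f i \<in> fun_span S) \<Longrightarrow> (\<lambda>x. \<Sum>i\<in>A. f i x) \<in> fun_span S"
  by (induction A rule: finite_induct) (auto intro: fun_span.intros)

lemma fun_span_polynomial: "f \<in> fun_span S \<Longrightarrow> (\<And>s. s \<in> S \<Longrightarrow> real_polynomial_function s) \<Longrightarrow> real_polynomial_function f"
  by (induction rule: fun_span.induct) auto

lemma fun_span_harmonic_polys: "f \<in> fun_span S \<Longrightarrow> S \<subseteq> harmonic_polys n \<Longrightarrow> f \<in> harmonic_polys n"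
  by (induction rule: fun_span.induct) (auto intro: harmonic_polys_zero harmonic_polys_add harmonic_polys_scale)

lemma fun_span_homogeneous_polys: "f \<in> fun_span S \<Longrightarrow> S \<subseteq> homogeneous_polys n \<Longrightarrow> f \<in> homogeneous_polys n"
  by (induction rule: fun_span.induct) (auto intro: homogeneous_polys_zero homogeneous_polys_add homogeneous_polys_scale)

fun monomials :: "nat \<Rightarrow> ('a::euclidean_space \<Rightarrow> real) set" where
  "monomials 0 = {\<lambda>x. 1}"
| "monomials (Suc n) = (\<lambda>(b, m) x. (x \<bullet> b) * m x) ` (Basis \<times> monomials n)"

lemma finite_monomials: "finite (monomials n :: ('a::euclidean_space \<Rightarrow> real) set)"
  by (induction n) auto

lemma monomials_homogeneous_polys: "monomials n \<subseteq> homogeneous_polys n"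
proof (induction n)
  case 0
  then show ?case by (auto simp: homogeneous_polys_def)
next
  case (Suc n)
  have "(\<lambda>x. (x \<bullet> b) * m x) \<in> homogeneous_polys (Suc n)" if "m \<in> homogeneous_polys n" for b :: 'a and m
  proof -
    have "(\<lambda>x. x \<bullet> b) \<in> homogeneous_polys 1" by (intro homogeneous_polysI real_polynomial_inner) simp
    from homogeneous_polys_mult[OF this that] show ?thesis by simp
  qed
  with Suc show ?case by auto
qed

lemma fun_span_monomials_Suc:
  assumes "f \<in> fun_span (monomials n)" "b \<in> Basis"
  shows "(\<lambda>x. (x \<bullet> b) * f x) \<in> fun_span (monomials (Suc n))"
  using assms
proof (induction rule: fun_span.induct)
  case (add f g)
  then show ?case using fun_span.add by (auto simp: distrib_left)
next
  case (scale f c)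
  then show ?case using fun_span.scale[of _ _ c] by (auto simp: mult.left_commute)
qed (auto intro: fun_span.intros)

lemma monomials_mult:
  assumes "g \<in> fun_span (monomials l)" "m \<in> monomials k"
  shows "(\<lambda>x. m x * g x) \<in> fun_span (monomials (k + l))"
  using assms(2)
proof (induction k arbitrary: m)
  case 0
  then show ?case using assms(1) by simp
next
  case (Suc k)
  then obtain b m' where m: "b \<in> Basis" "m' \<in> monomials k" "m = (\<lambda>x. (x \<bullet> b) * m' x)" by auto
  from fun_span_monomials_Suc[OF Suc.IH[OF m(2)] m(1)] show ?case by (simp add: m(3) mult.assoc)
qed

lemma fun_span_monomials_mult:
  assumes "f \<in> fun_span (monomials k)" "g \<in> fun_span (monomials l)"
  shows "(\<lambda>x. f x * g x) \<in> fun_span (monomials (k + l))"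
  using assms(1)
proof (induction rule: fun_span.induct)
  case (base s)
  then show ?case by (rule monomials_mult[OF assms(2)])
next
  case (add f g)
  then show ?case using fun_span.add by (auto simp: distrib_right)
next
  case (scale f c)
  then show ?case using fun_span.scale[of _ _ c] by (auto simp: mult.assoc)
qed (auto intro: fun_span.intros)

text \<open>
  The homogeneous components of \<open>p\<close> are the coefficients of the univariate polynomial
  \<open>t \<mapsto> p (t x)\<close>. Keeping the components inside the type of univariate polynomials provides sums,
  products and the comparison of coefficients. The uniform degree bound makes the number of components
  independent of \<open>x\<close>.
\<close>

lemma polynomial_homogeneous_expansion:
  fixes p :: "'a::euclidean_space \<Rightarrow> real"
  assumes "real_polynomial_function p"
  shows "\<exists>P N. \<forall>x. degree (P x) \<le> N \<and> (\<forall>t. poly (P x) t = p (t *\<^sub>R x)) \<and>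
      (\<forall>k. (\<lambda>x. coeff (P x) k) \<in> fun_span (monomials k))"
  using assms
proof induction
  case (linear f)
  have lin: "linear f" using linear by (rule bounded_linear.linear)
  have "(\<lambda>x. coeff [:0, f x:] k) \<in> fun_span (monomials k)" for k
  proof (cases "k = 1")
    case True
    have eq: "(\<lambda>x. coeff [:0, f x:] k) = (\<lambda>x. \<Sum>b\<in>Basis. f b * ((x \<bullet> b) * 1))"
    proof
      fix x
      show "coeff [:0, f x:] k = (\<Sum>b\<in>Basis. f b * ((x \<bullet> b) * 1))"
        using Linear_Algebra.linear_componentwise[OF lin, of x 1] True by (simp add: mult.commute)
    qed
    have "(\<lambda>x. \<Sum>b\<in>Basis. f b * ((x \<bullet> b) * 1)) \<in> fun_span (monomials (Suc 0))"
      by (intro fun_span_sum fun_span.scale fun_span_monomials_Suc fun_span.base finite_Basis) auto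
    then show ?thesis unfolding eq using True by simp
  next
    case False
    then have "coeff [:0, f x:] k = 0" for x by (auto simp: coeff_pCons split: nat.split)
    then show ?thesis by (simp add: fun_span.zero)
  qed
  then show ?case
    by (intro exI[of _ "\<lambda>x. [:0, f x:]"] exI[of _ 1]) (auto simp: linear_cmul[OF lin])
next
  case (const c)
  have "(\<lambda>x::'a. coeff [:c:] k) \<in> fun_span (monomials k)" for k
  proof (cases k)
    case 0
    have "(\<lambda>x::'a. c * 1) \<in> fun_span (monomials 0)" by (intro fun_span.scale fun_span.base) simp
    then show ?thesis using 0 by simp
  qed (simp add: fun_span.zero)
  then show ?case by (intro exI[of _ "\<lambda>x. [:c:]"] exI[of _ 0]) simp
next
  case (add f g)
  from add.IH obtain P N Q M where "\<forall>x. degree (P x) \<le> N \<and> (\<forall>t. poly (P x) t = f (t *\<^sub>R x)) \<and>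
      (\<forall>k. (\<lambda>x. coeff (P x) k) \<in> fun_span (monomials k))"
    "\<forall>x. degree (Q x) \<le> M \<and> (\<forall>t. poly (Q x) t = g (t *\<^sub>R x)) \<and>
      (\<forall>k. (\<lambda>x. coeff (Q x) k) \<in> fun_span (monomials k))" by blast
  then show ?case
    by (intro exI[of _ "\<lambda>x. P x + Q x"] exI[of _ "max N M"])
       (auto intro!: fun_span.add degree_add_le_max[THEN order_trans] max.mono)
next
  case (mult f g)
  from mult.IH obtain P N Q M where PQ: "\<forall>x. degree (P x) \<le> N \<and> (\<forall>t. poly (P x) t = f (t *\<^sub>R x)) \<and>
      (\<forall>k. (\<lambda>x. coeff (P x) k) \<in> fun_span (monomials k))"
    "\<forall>x. degree (Q x) \<le> M \<and> (\<forall>t. poly (Q x) t = g (t *\<^sub>R x)) \<and>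
      (\<forall>k. (\<lambda>x. coeff (Q x) k) \<in> fun_span (monomials k))" by blast
  have "(\<lambda>x. coeff (P x * Q x) k) \<in> fun_span (monomials k)" for k
    unfolding coeff_mult
  proof (rule fun_span_sum)
    fix i assume "i \<in> {..k}"
    then show "(\<lambda>x. coeff (P x) i * coeff (Q x) (k - i)) \<in> fun_span (monomials k)"
      using fun_span_monomials_mult[of "\<lambda>x. coeff (P x) i" i "\<lambda>x. coeff (Q x) (k - i)" "k - i"] PQ by simp
  qed simp
  then show ?case using PQ
    by (intro exI[of _ "\<lambda>x. P x * Q x"] exI[of _ "N + M"])
       (auto intro!: degree_mult_le[THEN order_trans] add_mono)
qed

lemma homogeneous_polys_fun_span_monomials:
  fixes p :: "'a::euclidean_space \<Rightarrow> real"
  assumes p: "p \<in> homogeneous_polys n"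
  shows "p \<in> fun_span (monomials n)"
proof -
  obtain P N where P: "\<And>x t. poly (P x) t = p (t *\<^sub>R x)" "\<And>k. (\<lambda>x. coeff (P x) k) \<in> fun_span (monomials k)"
    using polynomial_homogeneous_expansion[OF homogeneous_polys_polynomial[OF p]] by blast
  have "P x = monom (p x) n" for x
    by (rule poly_eq_poly_eq_iff[THEN iffD1]) (auto simp: P(1) homogeneous_polysD[OF p] poly_monom)
  then have "(\<lambda>x. coeff (P x) n) = p" by simp
  with P(2)[of n] show ?thesis by simp
qed

lemma polynomial_sum_harmonic_polys:
  fixes p :: "'a::euclidean_space \<Rightarrow> real"
  assumes p: "real_polynomial_function p"
  shows "\<exists>Z N. (\<forall>k. Z k \<in> harmonic_polys k) \<and> (\<forall>x. norm x = 1 \<longrightarrow> p x = (\<Sum>k\<le>N. Z k x))"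
proof -
  obtain P N where P: "\<And>x. degree (P x) \<le> N" "\<And>x t. poly (P x) t = p (t *\<^sub>R x)"
    "\<And>k. (\<lambda>x. coeff (P x) k) \<in> fun_span (monomials k)"
    using polynomial_homogeneous_expansion[OF p] by blast
  have "\<exists>Z. (\<forall>j. Z j \<in> harmonic_polys j) \<and> (\<forall>x. norm x = 1 \<longrightarrow> coeff (P x) k = (\<Sum>j\<le>k. Z j x))" for k
    using homogeneous_polys_sum_harmonic_polys[OF fun_span_homogeneous_polys[OF P(3) monomials_homogeneous_polys]] .
  then obtain Z where Z: "\<And>k j. Z k j \<in> harmonic_polys j"
    "\<And>k x. norm x = 1 \<Longrightarrow> coeff (P x) k = (\<Sum>j\<le>k. Z k j x)" by metis
  define W where "W j = (\<lambda>x. \<Sum>k\<in>{j..N}. Z k j x)" for j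
  have "W j \<in> harmonic_polys j" for j
    unfolding W_def
    using finite_atLeastAtMost[of j N] by (induction rule: finite_induct) (auto intro: harmonic_polys_zero harmonic_polys_add Z)
  moreover have "p x = (\<Sum>j\<le>N. W j x)" if x: "norm x = 1" for x
  proof -
    have "p x = poly (P x) 1" by (simp add: P(2))
    also have "\<dots> = (\<Sum>k\<le>N. coeff (P x) k)"
      by (simp add: poly_altdef, rule sum.mono_neutral_left) (use P(1)[of x] in \<open>auto simp: coeff_eq_0\<close>)
    also have "\<dots> = (\<Sum>k\<le>N. \<Sum>j\<le>k. Z k j x)" by (simp add: Z(2)[OF x])
    also have "\<dots> = (\<Sum>j\<le>N. W j x)"
    proof -
      have "(\<Sum>k\<le>N. \<Sum>j\<le>k. Z k j x) = (\<Sum>k\<le>N. \<Sum>j | j \<in> {..N} \<and> j \<le> k. Z k j x)"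
        by (intro sum.cong) auto
      also have "\<dots> = (\<Sum>j\<le>N. \<Sum>k | k \<in> {..N} \<and> j \<le> k. Z k j x)"
        by (rule sum.swap_restrict) auto
      also have "\<dots> = (\<Sum>j\<le>N. W j x)"
        unfolding W_def by (intro sum.cong) auto
      finally show ?thesis .
    qed
    finally show ?thesis .
  qed
  ultimately show ?thesis by blast
qed

section \<open>The inner product of square integrable functions\<close>

lemma sphere_L2_D:
  assumes "f \<in> sphere_L2"
  shows "f \<in> borel_measurable sphere_measure" "integrable sphere_measure (\<lambda>x. (f x)\<^sup>2)"
  using assms by (auto simp: sphere_L2_def)

lemma sphere_L2_mult_integrable:
  fixes f g :: "'a::euclidean_space \<Rightarrow> real"
  assumes f: "f \<in> sphere_L2" and g: "g \<in> sphere_L2"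
  shows "integrable sphere_measure (\<lambda>x. f x * g x)"
proof (rule Bochner_Integration.integrable_bound)
  show "integrable sphere_measure (\<lambda>x. (f x)\<^sup>2 + (g x)\<^sup>2)"
    using f g by (auto simp: sphere_L2_def)
  show "(\<lambda>x. f x * g x) \<in> borel_measurable sphere_measure"
    using f g by (auto simp: sphere_L2_def)
  have "\<bar>a * b\<bar> \<le> a\<^sup>2 + b\<^sup>2" for a b :: real
  proof -
    have "0 \<le> \<bar>a\<bar> * \<bar>b\<bar>" by simp
    moreover have "2 * (\<bar>a\<bar> * \<bar>b\<bar>) \<le> a\<^sup>2 + b\<^sup>2"
      using sum_squares_bound[of "\<bar>a\<bar>" "\<bar>b\<bar>"] by simp
    ultimately show ?thesis unfolding abs_mult by linarith
  qed
  then show "AE x in sphere_measure. norm (f x * g x) \<le> norm ((f x)\<^sup>2 + (g x)\<^sup>2)"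
    by (intro AE_I2) (simp add: order_trans[OF _ abs_ge_self])
qed

lemma sphere_L2_lincomb:
  fixes f g :: "'a::euclidean_space \<Rightarrow> real"
  assumes f: "f \<in> sphere_L2" and g: "g \<in> sphere_L2"
  shows "(\<lambda>x. a * f x + b * g x) \<in> sphere_L2"
proof -
  have "integrable sphere_measure (\<lambda>x. a\<^sup>2 * (f x)\<^sup>2 + 2 * a * b * (f x * g x) + b\<^sup>2 * (g x)\<^sup>2)"
    using sphere_L2_D[OF f] sphere_L2_D[OF g] sphere_L2_mult_integrable[OF f g] by auto
  moreover have "(a * s + b * t)\<^sup>2 = a\<^sup>2 * s\<^sup>2 + 2 * a * b * (s * t) + b\<^sup>2 * t\<^sup>2" for s t
    by (simp add: power2_eq_square algebra_simps)
  ultimately have "integrable sphere_measure (\<lambda>x. (a * f x + b * g x)\<^sup>2)" by simp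
  moreover have "(\<lambda>x. a * f x + b * g x) \<in> borel_measurable sphere_measure"
    using sphere_L2_D[OF f] sphere_L2_D[OF g] by auto
  ultimately show ?thesis by (simp add: sphere_L2_def)
qed

lemma sphere_L2_scale:
  fixes f :: "'a::euclidean_space \<Rightarrow> real"
  shows "f \<in> sphere_L2 \<Longrightarrow> (\<lambda>x. c * f x) \<in> sphere_L2"
  using sphere_L2_lincomb[of f f c 0] by simp

lemma sphere_L2_diff:
  fixes f g :: "'a::euclidean_space \<Rightarrow> real"
  shows "f \<in> sphere_L2 \<Longrightarrow> g \<in> sphere_L2 \<Longrightarrow> (\<lambda>x. f x - g x) \<in> sphere_L2"
  using sphere_L2_lincomb[of f g 1 "-1"] by simp

lemma continuous_sphere_L2:
  fixes f :: "'a::euclidean_space \<Rightarrow> real"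
  shows "continuous_on (sphere 0 1) f \<Longrightarrow> f \<in> sphere_L2"
  by (auto simp: sphere_L2_def intro!: borel_measurable_sphere_continuous integrable_sphere_continuous continuous_intros)

lemma polynomial_sphere_L2: "real_polynomial_function f \<Longrightarrow> f \<in> sphere_L2"
  by (intro continuous_sphere_L2 continuous_on_polynomial)

lemma sphere_L2_sum:
  fixes f :: "'i \<Rightarrow> 'a::euclidean_space \<Rightarrow> real"
  shows "finite I \<Longrightarrow> (\<And>i. i \<in> I \<Longrightarrow> f i \<in> sphere_L2) \<Longrightarrow> (\<lambda>x. \<Sum>i\<in>I. f i x) \<in> sphere_L2"
proof (induction I rule: finite_induct)
  case (insert i I)
  then show ?case using sphere_L2_lincomb[of "f i" "\<lambda>x. \<Sum>i\<in>I. f i x" 1 1] by simp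
qed (simp add: polynomial_sphere_L2 real_polynomial_function.intros(2))

definition sphere_inner :: "('a::euclidean_space \<Rightarrow> real) \<Rightarrow> ('a \<Rightarrow> real) \<Rightarrow> real" where
  "sphere_inner f g = (LINT x|sphere_measure. f x * g x)"

lemma sphere_inner_commute: "sphere_inner f g = sphere_inner g f"
  by (simp add: sphere_inner_def mult.commute)

lemma sphere_inner_cong:
  "(\<And>x. norm x = 1 \<Longrightarrow> f x = f' x) \<Longrightarrow> (\<And>x. norm x = 1 \<Longrightarrow> g x = g' x) \<Longrightarrow> sphere_inner f g = sphere_inner f' g'"
  unfolding sphere_inner_def by (rule integral_sphere_cong) simp

lemma sphere_inner_diff_left:
  fixes f g h :: "'a::euclidean_space \<Rightarrow> real"
  assumes "f \<in> sphere_L2" "g \<in> sphere_L2" "h \<in> sphere_L2"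
  shows "sphere_inner (\<lambda>x. f x - g x) h = sphere_inner f h - sphere_inner g h"
  using assms by (simp add: sphere_inner_def left_diff_distrib sphere_L2_mult_integrable)

lemma sphere_inner_add_right:
  fixes f g h :: "'a::euclidean_space \<Rightarrow> real"
  assumes "f \<in> sphere_L2" "g \<in> sphere_L2" "h \<in> sphere_L2"
  shows "sphere_inner h (\<lambda>x. f x + g x) = sphere_inner h f + sphere_inner h g"
  using assms by (simp add: sphere_inner_def distrib_left sphere_L2_mult_integrable)

lemma sphere_inner_scale_right: "sphere_inner h (\<lambda>x. c * f x) = c * sphere_inner h f"
proof -
  have "sphere_inner h (\<lambda>x. c * f x) = (LINT x|sphere_measure. c * (h x * f x))"
    unfolding sphere_inner_def by (simp add: mult.left_commute)
  then show ?thesis by (simp add: sphere_inner_def)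
qed

lemma sphere_inner_scale_left: "sphere_inner (\<lambda>x. c * f x) h = c * sphere_inner f h"
  using sphere_inner_scale_right by (metis sphere_inner_commute)

lemma sphere_inner_sum_right:
  fixes f :: "'i \<Rightarrow> 'a::euclidean_space \<Rightarrow> real"
  assumes "\<And>i. i \<in> I \<Longrightarrow> f i \<in> sphere_L2" "h \<in> sphere_L2"
  shows "sphere_inner h (\<lambda>x. \<Sum>i\<in>I. f i x) = (\<Sum>i\<in>I. sphere_inner h (f i))"
  using assms by (simp add: sphere_inner_def sum_distrib_left sphere_L2_mult_integrable)

lemma sphere_inner_self_nonneg: "0 \<le> sphere_inner f f"
  unfolding sphere_inner_def by (rule integral_sphere_nonneg) simp

lemma sphere_inner_self_eq_0:
  assumes "real_polynomial_function f" "sphere_inner f f = 0" "norm x = 1"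
  shows "f x = 0"
proof -
  have "f x * f x = 0"
    using assms unfolding sphere_inner_def
    by (intro continuous_integral_sphere_eq_0[of "\<lambda>x. f x * f x"] continuous_intros continuous_on_polynomial) auto
  then show ?thesis by simp
qed

lemma harmonic_polys_inner_orthogonal:
  fixes Y Z :: "'a::euclidean_space \<Rightarrow> real"
  shows "Y \<in> harmonic_polys n \<Longrightarrow> Z \<in> harmonic_polys m \<Longrightarrow> n \<noteq> m \<Longrightarrow> DIM('a) \<ge> 2 \<Longrightarrow> sphere_inner Y Z = 0"
  unfolding sphere_inner_def by (rule harmonic_polys_orthogonal)

lemma harmonic_polys_L2: "Y \<in> harmonic_polys n \<Longrightarrow> Y \<in> sphere_L2"
  by (intro polynomial_sphere_L2 harmonic_polys_polynomial)

section \<open>Projections onto spherical harmonics\<close>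

text \<open>
  The harmonic parts \<open>H p\<close> of the monomials \<open>p\<close> span. Expanding a harmonic \<open>Z\<close> in monomials
  gives \<open>Z = Y + |x|\<^sup>2 r\<close> with \<open>Y\<close> in this span. Then \<open>|x|\<^sup>2 r = Z - Y\<close> is harmonic of degree \<open>n\<close>, whereas
  \<open>r\<close> is on the sphere a sum of harmonics of degree less than \<open>n\<close>; so \<open>r\<close> is orthogonal to itself and
  vanishes there.
\<close>

lemma harmonic_polys_finite_span:
  assumes d: "DIM('a::euclidean_space) \<ge> 2"
  shows "\<exists>B. finite B \<and> B \<subseteq> harmonic_polys n \<and>
    (\<forall>Z\<in>harmonic_polys n. \<exists>Y\<in>fun_span B. \<forall>x::'a. norm x = 1 \<longrightarrow> Z x = Y x)"
proof (cases "n < 2")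
  case True
  have "monomials n \<subseteq> (harmonic_polys n :: ('a \<Rightarrow> real) set)"
    using monomials_homogeneous_polys homogeneous_polys_low_harmonic_polys[OF _ True] by blast
  moreover have "Z \<in> fun_span (monomials n)" if "Z \<in> harmonic_polys n" for Z :: "'a \<Rightarrow> real"
    by (rule homogeneous_polys_fun_span_monomials[OF harmonic_polys_homogeneous_polys[OF that]])
  ultimately show ?thesis
    using finite_monomials by (intro exI[of _ "monomials n"]) auto
next
  case False
  then obtain m where n: "n = Suc (Suc m)" by (metis add_2_eq_Suc not_less le_Suc_ex)
  have "\<forall>p\<in>monomials n. \<exists>Y r. Y \<in> harmonic_polys n \<and> r \<in> homogeneous_polys m \<and> (\<forall>x::'a. p x = Y x + (x \<bullet> x) * r x)"
    using harmonic_decomposition monomials_homogeneous_polys unfolding n by blast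
  then obtain H R where H: "\<And>p. p \<in> monomials n \<Longrightarrow> H p \<in> harmonic_polys n" and R: "\<And>p. p \<in> monomials n \<Longrightarrow> R p \<in> homogeneous_polys m"
    and HR: "\<And>p x. p \<in> monomials n \<Longrightarrow> p (x::'a) = H p x + (x \<bullet> x) * R p x"
    by metis
  let ?B = "H ` monomials n"
  have split: "\<exists>Y\<in>fun_span ?B. \<exists>r\<in>homogeneous_polys m. \<forall>x. p x = Y x + (x \<bullet> x) * r x" if "p \<in> fun_span (monomials n)" for p
    using that
  proof (induction rule: fun_span.induct)
    case zero
    then show ?case by (intro bexI[of _ "\<lambda>x. 0"]) (auto intro: fun_span.zero homogeneous_polys_zero)
  next
    case (base s)
    then show ?case using R[OF base] HR[OF base] by (intro bexI[of _ "H s"] bexI[of _ "R s"]) (auto intro: fun_span.base)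
  next
    case (add f g)
    then obtain Y r Y' r' where "Y \<in> fun_span ?B" "r \<in> homogeneous_polys m" "\<And>x. f x = Y x + (x \<bullet> x) * r x"
      "Y' \<in> fun_span ?B" "r' \<in> homogeneous_polys m" "\<And>x. g x = Y' x + (x \<bullet> x) * r' x" by blast
    then show ?case
      by (intro bexI[of _ "\<lambda>x. Y x + Y' x"] bexI[of _ "\<lambda>x. r x + r' x"])
         (auto intro: fun_span.add homogeneous_polys_add simp: algebra_simps)
  next
    case (scale f c)
    then obtain Y r where "Y \<in> fun_span ?B" "r \<in> homogeneous_polys m" "\<And>x. f x = Y x + (x \<bullet> x) * r x" by blast
    then show ?case
      by (intro bexI[of _ "\<lambda>x. c * Y x"] bexI[of _ "\<lambda>x. c * r x"])
         (auto intro: fun_span.scale homogeneous_polys_scale simp: algebra_simps)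
  qed
  have "\<exists>Y\<in>fun_span ?B. \<forall>x. norm x = 1 \<longrightarrow> Z x = Y x" if Z: "Z \<in> harmonic_polys n" for Z
  proof -
    obtain Y r where Y: "Y \<in> fun_span ?B" and r: "r \<in> homogeneous_polys m" and ZY: "\<And>x. Z x = Y x + (x \<bullet> x) * r x"
      using split[OF homogeneous_polys_fun_span_monomials[OF harmonic_polys_homogeneous_polys[OF Z]]] by blast
    have Yh: "Y \<in> harmonic_polys n" using fun_span_harmonic_polys[OF Y] H by blast
    let ?D = "\<lambda>x. Z x + (-1) * Y x"
    have D: "?D \<in> harmonic_polys n" by (intro harmonic_polys_add harmonic_polys_scale Z Yh)
    obtain W where W: "\<And>k. W k \<in> harmonic_polys k" "\<And>x. norm x = 1 \<Longrightarrow> r x = (\<Sum>k\<le>m. W k x)"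
      using homogeneous_polys_sum_harmonic_polys[OF r] by blast
    have "sphere_inner r r = sphere_inner ?D (\<lambda>x. \<Sum>k\<le>m. W k x)"
      by (rule sphere_inner_cong) (auto simp: ZY norm_eq_1 W(2))
    also have "\<dots> = (\<Sum>k\<le>m. sphere_inner ?D (W k))"
      by (rule sphere_inner_sum_right) (rule harmonic_polys_L2[OF W(1)], rule harmonic_polys_L2[OF D])
    also have "\<dots> = 0"
      by (rule sum.neutral) (use harmonic_polys_inner_orthogonal[OF D W(1) _ d] n in auto)
    finally have "r x = 0" if "norm x = 1" for x
      using sphere_inner_self_eq_0[OF homogeneous_polys_polynomial[OF r]] that by blast
    then show ?thesis using Y ZY by auto
  qed
  moreover have "finite ?B" "?B \<subseteq> harmonic_polys n" using finite_monomials H by auto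
  ultimately show ?thesis by blast
qed

text \<open>
  Gram--Schmidt: \<open>s'\<close> is the part of the new function \<open>s\<close> orthogonal to the previous span.
\<close>

lemma projection_on_finite_span:
  fixes f :: "'a::euclidean_space \<Rightarrow> real"
  assumes "finite B" "\<And>s. s \<in> B \<Longrightarrow> real_polynomial_function s" "f \<in> sphere_L2"
  shows "\<exists>Y\<in>fun_span B. \<forall>Z\<in>fun_span B. sphere_inner (\<lambda>x. f x - Y x) Z = 0"
  using assms
proof (induction B arbitrary: f rule: finite_induct)
  case empty
  have "sphere_inner f Z = 0" if "Z \<in> fun_span {}" for Z
    using that
  proof (induction rule: fun_span.induct)
    case (add g h)
    then have "real_polynomial_function g" "real_polynomial_function h" using fun_span_polynomial[of _ "{}"] by auto
    then show ?case using add empty.prems by (simp add: sphere_inner_add_right polynomial_sphere_L2)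
  qed (auto simp: sphere_inner_scale_right sphere_inner_def)
  then show ?case by (intro bexI[of _ "\<lambda>x. 0"]) (auto intro: fun_span.zero)
next
  case (insert s B)
  have sub: "g \<in> fun_span (insert s B)" if "g \<in> fun_span B" for g
    using fun_span_mono[of B "insert s B"] that by blast
  have polyB: "real_polynomial_function g" if "g \<in> fun_span (insert s B)" for g
    using fun_span_polynomial[OF that] insert.prems by blast
  have L2: "g \<in> sphere_L2" if "g \<in> fun_span (insert s B)" for g
    using polynomial_sphere_L2[OF polyB[OF that]] .
  have s: "s \<in> fun_span (insert s B)" by (intro fun_span.base) simp
  obtain Yf where Yf: "Yf \<in> fun_span B" "\<And>Z. Z \<in> fun_span B \<Longrightarrow> sphere_inner (\<lambda>x. f x - Yf x) Z = 0"
    using insert.IH[of f] insert.prems by blast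
  obtain Ys where Ys: "Ys \<in> fun_span B" "\<And>Z. Z \<in> fun_span B \<Longrightarrow> sphere_inner (\<lambda>x. s x - Ys x) Z = 0"
    using insert.IH[of s] insert.prems L2[OF s] by blast
  note fL2 = \<open>f \<in> sphere_L2\<close> L2[OF sub[OF Yf(1)]] L2[OF sub[OF Ys(1)]] L2[OF s]
  define s' where "s' x = s x - Ys x" for x
  have s'B: "s' \<in> fun_span (insert s B)"
    using fun_span.add[OF s fun_span.scale[OF sub[OF Ys(1)], of "-1"]] by (simp add: s'_def[abs_def])
  have s'0: "sphere_inner s' Z = 0" if "Z \<in> fun_span B" for Z
    using Ys(2)[OF that] by (simp add: s'_def[abs_def])
  define c where "c = sphere_inner f s' / sphere_inner s' s'"
  define Y where "Y x = Yf x + c * s' x" for x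
  have Y: "Y \<in> fun_span (insert s B)"
    unfolding Y_def[abs_def] by (intro fun_span.add fun_span.scale s'B sub Yf(1))
  have fY: "sphere_inner (\<lambda>x. f x - Y x) Z = sphere_inner (\<lambda>x. f x - Yf x) Z - c * sphere_inner s' Z"
    if Z: "Z \<in> sphere_L2" for Z
  proof -
    have "sphere_inner (\<lambda>x. f x - Y x) Z = sphere_inner (\<lambda>x. (f x - Yf x) - c * s' x) Z"
      by (simp add: Y_def algebra_simps)
    also have "\<dots> = sphere_inner (\<lambda>x. f x - Yf x) Z - sphere_inner (\<lambda>x. c * s' x) Z"
      by (intro sphere_inner_diff_left sphere_L2_diff sphere_L2_scale fL2 L2[OF s'B] Z)
    finally show ?thesis by (simp add: sphere_inner_scale_left)
  qed
  have B: "sphere_inner (\<lambda>x. f x - Y x) Z = 0" if "Z \<in> fun_span B" for Z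
    using that by (simp add: fY L2 sub Yf(2) s'0)
  have ss': "sphere_inner (\<lambda>x. f x - Y x) s' = 0"
  proof (cases "sphere_inner s' s' = 0")
    case True
    then have "s' x = 0" if "norm x = 1" for x
      using sphere_inner_self_eq_0[OF polyB[OF s'B]] that by blast
    then have "sphere_inner (\<lambda>x. f x - Y x) s' = sphere_inner (\<lambda>x. f x - Y x) (\<lambda>x. 0)"
      by (intro sphere_inner_cong) auto
    then show ?thesis by (simp add: sphere_inner_def)
  next
    case False
    have "sphere_inner (\<lambda>x. f x - Yf x) s' = sphere_inner f s' - sphere_inner Yf s'"
      by (intro sphere_inner_diff_left fL2 L2[OF s'B])
    also have "sphere_inner Yf s' = 0" using s'0[OF Yf(1)] by (simp add: sphere_inner_commute)
    finally show ?thesis using False by (simp add: fY L2[OF s'B] c_def)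
  qed
  have "sphere_inner (\<lambda>x. f x - Y x) s = sphere_inner (\<lambda>x. f x - Y x) (\<lambda>x. s' x + Ys x)"
    by (simp add: s'_def)
  also have "\<dots> = 0"
    using ss' B[OF Ys(1)] by (subst sphere_inner_add_right) (auto intro: sphere_L2_diff fL2 L2 s'B Y)
  finally have fs: "sphere_inner (\<lambda>x. f x - Y x) s = 0" .
  have "sphere_inner (\<lambda>x. f x - Y x) Z = 0" if "Z \<in> fun_span (insert s B)" for Z
    using that
  proof (induction rule: fun_span.induct)
    case (base t)
    then show ?case using fs B fun_span.base by blast
  next
    case (add g h)
    then show ?case by (subst sphere_inner_add_right) (auto intro: sphere_L2_diff fL2 L2 Y)
  qed (auto simp: sphere_inner_scale_right, simp add: sphere_inner_def)
  with Y show ?case by blast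
qed

text \<open>
  Existence comes from the finite spanning set. Uniqueness holds because two candidates differ by a
  harmonic polynomial orthogonal to itself; this is what gives the definite description in \<open>proj\<close> its
  meaning.
\<close>

theorem proj_characterization:
  fixes f :: "'a::euclidean_space \<Rightarrow> real"
  assumes f: "f \<in> sphere_L2" and d: "DIM('a) \<ge> 2"
  shows "\<exists>Y\<in>harmonic_polys n. (\<forall>x\<in>sphere 0 1. proj n f x = Y x) \<and> (\<forall>Z\<in>harmonic_polys n. sphere_inner f Z = sphere_inner Y Z)"
proof -
  let ?r = "\<lambda>p::'a \<Rightarrow> real. restrict p (sphere 0 1)"
  have SH: "spherical_harmonics n = ?r ` harmonic_polys n"
    by (auto simp: spherical_harmonics_def harmonic_polys_def homogeneous_polys_def)
  obtain B where B: "finite B" "B \<subseteq> harmonic_polys n" "\<And>Z. Z \<in> harmonic_polys n \<Longrightarrow> \<exists>Y\<in>fun_span B. \<forall>x::'a. norm x = 1 \<longrightarrow> Z x = Y x"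
    using harmonic_polys_finite_span[OF d, of n] by blast
  obtain Y where Y: "Y \<in> fun_span B" "\<And>Z. Z \<in> fun_span B \<Longrightarrow> sphere_inner (\<lambda>x. f x - Y x) Z = 0"
    using projection_on_finite_span[OF B(1) _ f] B(2) harmonic_polys_polynomial by blast
  have Yh: "Y \<in> harmonic_polys n" using fun_span_harmonic_polys[OF Y(1) B(2)] .
  have orth: "sphere_inner (\<lambda>x. f x - Y x) Z = 0" if Z: "Z \<in> harmonic_polys n" for Z
  proof -
    obtain Z' where "Z' \<in> fun_span B" "\<forall>x. norm x = 1 \<longrightarrow> Z x = Z' x" using B(3)[OF Z] by blast
    then show ?thesis using Y(2)[of Z'] sphere_inner_cong[of "\<lambda>x. f x - Y x" "\<lambda>x. f x - Y x" Z Z'] by simp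
  qed
  have eq: "sphere_inner f Z = sphere_inner Y Z" if "Z \<in> harmonic_polys n" for Z
    using orth[OF that] sphere_inner_diff_left[OF f harmonic_polys_L2[OF Yh] harmonic_polys_L2[OF that]] by simp
  have restr: "(LINT x|sphere_measure. (f x - ?r U x) * ?r Z x) = sphere_inner (\<lambda>x. f x - U x) Z" for U Z
    unfolding sphere_inner_def by (rule integral_sphere_cong) simp
  have "proj n f = ?r Y"
    unfolding proj_def SH
  proof (rule the_equality)
    show "?r Y \<in> ?r ` harmonic_polys n \<and> (\<forall>Z\<in>?r ` harmonic_polys n. (LINT x|sphere_measure. (f x - ?r Y x) * Z x) = 0)"
      using Yh orth restr by auto
  next
    fix U assume "U \<in> ?r ` harmonic_polys n \<and> (\<forall>Z\<in>?r ` harmonic_polys n. (LINT x|sphere_measure. (f x - U x) * Z x) = 0)"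
    then obtain V where V: "V \<in> harmonic_polys n" "U = ?r V" and 0: "\<And>Z. Z \<in> harmonic_polys n \<Longrightarrow> sphere_inner (\<lambda>x. f x - V x) Z = 0"
      using restr by auto
    let ?D = "\<lambda>x. Y x + (-1) * V x"
    have D: "?D \<in> harmonic_polys n" by (intro harmonic_polys_add harmonic_polys_scale V Yh)
    have "sphere_inner f ?D = sphere_inner V ?D"
      using 0[OF D] sphere_inner_diff_left[OF f harmonic_polys_L2[OF V(1)] harmonic_polys_L2[OF D]] by simp
    then have "sphere_inner (\<lambda>x. Y x - V x) ?D = 0"
      using eq[OF D] sphere_inner_diff_left[OF harmonic_polys_L2[OF Yh] harmonic_polys_L2[OF V(1)] harmonic_polys_L2[OF D]] by simp
    then have "sphere_inner ?D ?D = 0" by simp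
    then have "?D x = 0" if "norm x = 1" for x
      using sphere_inner_self_eq_0[OF harmonic_polys_polynomial[OF D]] that by blast
    then show "U = ?r Y" unfolding V(2) by (intro restrict_ext) auto
  qed
  then show ?thesis using Yh eq by (intro bexI[of _ Y]) auto
qed

section \<open>Polynomials are dense in the square integrable functions\<close>

definition poly_approximable :: "('a::euclidean_space \<Rightarrow> real) \<Rightarrow> bool" where
  "poly_approximable f \<longleftrightarrow> f \<in> sphere_L2 \<and>
     (\<forall>e>0. \<exists>p. real_polynomial_function p \<and> (LINT x|sphere_measure. (f x - p x)\<^sup>2) < e)"

lemma L2_diff_sq_integrable:
  fixes f g :: "'a::euclidean_space \<Rightarrow> real"
  shows "f \<in> sphere_L2 \<Longrightarrow> g \<in> sphere_L2 \<Longrightarrow> integrable sphere_measure (\<lambda>x. (f x - g x)\<^sup>2)"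
  using sphere_L2_D(2)[OF sphere_L2_diff] by blast

lemma L2_triangle_sq:
  fixes f g h :: "'a::euclidean_space \<Rightarrow> real"
  assumes "f \<in> sphere_L2" "g \<in> sphere_L2" "h \<in> sphere_L2"
  shows "(LINT x|sphere_measure. (f x - h x)\<^sup>2)
    \<le> 2 * (LINT x|sphere_measure. (f x - g x)\<^sup>2) + 2 * (LINT x|sphere_measure. (g x - h x)\<^sup>2)"
proof -
  note int = L2_diff_sq_integrable[OF assms(1,2)] L2_diff_sq_integrable[OF assms(2,3)] L2_diff_sq_integrable[OF assms(1,3)]
  have "(a - c)\<^sup>2 \<le> 2 * (a - b)\<^sup>2 + 2 * (b - c)\<^sup>2" for a b c :: real
  proof -
    have "2 * (a - b)\<^sup>2 + 2 * (b - c)\<^sup>2 - (a - c)\<^sup>2 = (a - 2 * b + c)\<^sup>2"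
      by (simp add: power2_eq_square algebra_simps)
    then show ?thesis by (metis diff_ge_0_iff_ge zero_le_power2)
  qed
  then have "(LINT x|sphere_measure. (f x - h x)\<^sup>2)
    \<le> (LINT x|sphere_measure. 2 * (f x - g x)\<^sup>2 + 2 * (g x - h x)\<^sup>2)"
    using int by (intro integral_sphere_mono) auto
  then show ?thesis using int by simp
qed

lemma poly_approximableI:
  fixes f :: "'a::euclidean_space \<Rightarrow> real"
  assumes f: "f \<in> sphere_L2"
    and F: "\<And>e. e > 0 \<Longrightarrow> \<exists>g. poly_approximable g \<and> (LINT x|sphere_measure. (f x - g x)\<^sup>2) < e"
  shows "poly_approximable f"
  unfolding poly_approximable_def
proof (intro conjI allI impI f)
  fix e :: real assume "e > 0"
  then have e: "e / 4 > 0" by simp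
  obtain g where g: "poly_approximable g" "(LINT x|sphere_measure. (f x - g x)\<^sup>2) < e / 4"
    using F[OF e] by blast
  obtain p where p: "real_polynomial_function p" "(LINT x|sphere_measure. (g x - p x)\<^sup>2) < e / 4"
    using g(1) e unfolding poly_approximable_def by blast
  have "(LINT x|sphere_measure. (f x - p x)\<^sup>2) < e"
    using L2_triangle_sq[OF f _ polynomial_sphere_L2[OF p(1)], of g] g p(2) by (simp add: poly_approximable_def)
  with p show "\<exists>p. real_polynomial_function p \<and> (LINT x|sphere_measure. (f x - p x)\<^sup>2) < e" by blast
qed

lemma poly_approximable_lincomb:
  fixes f g :: "'a::euclidean_space \<Rightarrow> real"
  assumes f: "poly_approximable f" and g: "poly_approximable g"
  shows "poly_approximable (\<lambda>x. a * f x + b * g x)"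
proof -
  have fg: "f \<in> sphere_L2" "g \<in> sphere_L2" using f g by (auto simp: poly_approximable_def)
  have L2: "(\<lambda>x. a * f x + b * g x) \<in> sphere_L2" by (rule sphere_L2_lincomb[OF fg])
  show ?thesis unfolding poly_approximable_def
  proof (intro conjI allI impI L2)
    fix e :: real assume e: "e > 0"
    \<comment> \<open>The summand \<open>1\<close> keeps \<open>K\<close> positive when \<open>a\<close> and \<open>b\<close> vanish and makes the final estimate strict.\<close>
    define K where "K = 2 * a\<^sup>2 + 2 * b\<^sup>2 + 1"
    have K: "K > 0" unfolding K_def by (simp add: add_nonneg_pos)
    have eK: "e / K > 0" using e K by simp
    obtain p where p: "real_polynomial_function p" "(LINT x|sphere_measure. (f x - p x)\<^sup>2) < e / K"
      using f eK unfolding poly_approximable_def by blast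
    obtain q where q: "real_polynomial_function q" "(LINT x|sphere_measure. (g x - q x)\<^sup>2) < e / K"
      using g eK unfolding poly_approximable_def by blast
    note pq = polynomial_sphere_L2[OF p(1)] polynomial_sphere_L2[OF q(1)]
    let ?r = "\<lambda>x. a * p x + b * q x"
    have r: "real_polynomial_function ?r" by (intro real_polynomial_function.intros(2-) p q)
    have *: "(a * s + b * t - (a * u + b * v))\<^sup>2 \<le> 2 * a\<^sup>2 * (s - u)\<^sup>2 + 2 * b\<^sup>2 * (t - v)\<^sup>2" for s t u v :: real
    proof -
      have "2 * a\<^sup>2 * (s - u)\<^sup>2 + 2 * b\<^sup>2 * (t - v)\<^sup>2 - (a * s + b * t - (a * u + b * v))\<^sup>2
        = (a * (s - u) - b * (t - v))\<^sup>2"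
        by (simp add: power2_eq_square algebra_simps)
      then show ?thesis by (metis diff_ge_0_iff_ge zero_le_power2)
    qed
    have "(LINT x|sphere_measure. (a * f x + b * g x - ?r x)\<^sup>2)
        \<le> (LINT x|sphere_measure. 2 * a\<^sup>2 * (f x - p x)\<^sup>2 + 2 * b\<^sup>2 * (g x - q x)\<^sup>2)"
      using * L2_diff_sq_integrable[OF fg(1) pq(1)] L2_diff_sq_integrable[OF fg(2) pq(2)]
        L2_diff_sq_integrable[OF L2 polynomial_sphere_L2[OF r]]
      by (intro integral_sphere_mono) auto
    also have "\<dots> = 2 * a\<^sup>2 * (LINT x|sphere_measure. (f x - p x)\<^sup>2) + 2 * b\<^sup>2 * (LINT x|sphere_measure. (g x - q x)\<^sup>2)"
      using L2_diff_sq_integrable[OF fg(1) pq(1)] L2_diff_sq_integrable[OF fg(2) pq(2)] by simp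
    also have "\<dots> \<le> 2 * a\<^sup>2 * (e / K) + 2 * b\<^sup>2 * (e / K)"
      using p(2) q(2) by (intro add_mono mult_left_mono) auto
    also have "\<dots> = (2 * a\<^sup>2 + 2 * b\<^sup>2) * (e / K)" by (simp only: distrib_right)
    also have "\<dots> < K * (e / K)"
      by (rule mult_strict_right_mono[OF _ eK]) (simp add: K_def)
    also have "\<dots> = e" using K by simp
    finally show "\<exists>p. real_polynomial_function p \<and> (LINT x|sphere_measure. (a * f x + b * g x - p x)\<^sup>2) < e"
      using r by blast
  qed
qed

lemma poly_approximable_polynomial: "real_polynomial_function p \<Longrightarrow> poly_approximable p"
  unfolding poly_approximable_def using polynomial_sphere_L2[of p] by (auto intro!: exI[of _ p])

lemma poly_approximable_sum:
  fixes f :: "'i \<Rightarrow> 'a::euclidean_space \<Rightarrow> real"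
  shows "finite I \<Longrightarrow> (\<And>i. i \<in> I \<Longrightarrow> poly_approximable (f i)) \<Longrightarrow> poly_approximable (\<lambda>x. \<Sum>i\<in>I. f i x)"
proof (induction I rule: finite_induct)
  case (insert i I)
  then show ?case using poly_approximable_lincomb[of "f i" "\<lambda>x. \<Sum>i\<in>I. f i x" 1 1] by simp
qed (simp add: poly_approximable_polynomial real_polynomial_function.intros(2))

lemma poly_approximable_cong:
  fixes f g :: "'a::euclidean_space \<Rightarrow> real"
  assumes f: "poly_approximable f" and fg: "\<And>x. norm x = 1 \<Longrightarrow> f x = g x"
  shows "poly_approximable g"
proof (rule poly_approximableI)
  have "g \<in> borel_measurable sphere_measure"
    using f fg by (subst measurable_cong[of _ _ f]) (auto simp: poly_approximable_def sphere_L2_def)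
  moreover have "integrable sphere_measure (\<lambda>x. (g x)\<^sup>2)"
    using f fg by (subst Bochner_Integration.integrable_cong[OF refl, of _ _ "\<lambda>x. (f x)\<^sup>2"]) (auto simp: poly_approximable_def sphere_L2_def)
  ultimately show "g \<in> sphere_L2" by (simp add: sphere_L2_def)
  fix e :: real assume "e > 0"
  moreover have "(LINT x|sphere_measure. (g x - f x)\<^sup>2) = (LINT x::'a|sphere_measure. 0)"
    by (rule integral_sphere_cong) (simp add: fg)
  ultimately show "\<exists>h. poly_approximable h \<and> (LINT x|sphere_measure. (g x - h x)\<^sup>2) < e"
    using f by (intro exI[of _ f]) simp
qed

lemma poly_approximable_limit:
  fixes f w :: "'a::euclidean_space \<Rightarrow> real"
  assumes f: "f \<in> sphere_L2" and w: "w \<in> sphere_L2" and F: "\<And>i. poly_approximable (F i)"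
    and lim: "\<And>x. norm x = 1 \<Longrightarrow> (\<lambda>i. F i x) \<longlonglongrightarrow> f x"
    and bound: "\<And>i x. norm x = 1 \<Longrightarrow> \<bar>F i x\<bar> \<le> \<bar>w x\<bar>"
  shows "poly_approximable f"
proof (rule poly_approximableI[OF f])
  fix e :: real assume e: "e > 0"
  have FL2: "F i \<in> sphere_L2" for i using F by (simp add: poly_approximable_def)
  have "(\<lambda>i. LINT x|sphere_measure. (f x - F i x)\<^sup>2) \<longlonglongrightarrow> (LINT x::'a|sphere_measure. 0)"
  proof (rule integral_dominated_convergence[where w = "\<lambda>x. 2 * (f x)\<^sup>2 + 2 * (w x)\<^sup>2"])
    show "integrable sphere_measure (\<lambda>x. 2 * (f x)\<^sup>2 + 2 * (w x)\<^sup>2)"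
      using sphere_L2_D(2)[OF f] sphere_L2_D(2)[OF w] by simp
    show "(\<lambda>x. (f x - F i x)\<^sup>2) \<in> borel_measurable sphere_measure" for i
      using L2_diff_sq_integrable[OF f FL2] by (rule borel_measurable_integrable)
    show "AE x in sphere_measure. (\<lambda>i. (f x - F i x)\<^sup>2) \<longlonglongrightarrow> 0"
    proof (rule AE_I2)
      fix x :: 'a assume "x \<in> space sphere_measure"
      then have "(\<lambda>i. (f x - F i x)\<^sup>2) \<longlonglongrightarrow> (f x - f x)\<^sup>2"
        by (intro tendsto_intros lim) simp
      then show "(\<lambda>i. (f x - F i x)\<^sup>2) \<longlonglongrightarrow> 0" by simp
    qed
    show "AE x in sphere_measure. norm ((f x - F i x)\<^sup>2) \<le> 2 * (f x)\<^sup>2 + 2 * (w x)\<^sup>2" for i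
    proof (rule AE_I2)
      fix x :: 'a assume "x \<in> space sphere_measure"
      then have "(F i x)\<^sup>2 \<le> (w x)\<^sup>2" using bound[of x i] by (simp add: abs_le_square_iff)
      moreover have "(f x - F i x)\<^sup>2 + (f x + F i x)\<^sup>2 = 2 * (f x)\<^sup>2 + 2 * (F i x)\<^sup>2"
        by (simp add: power2_eq_square algebra_simps)
      ultimately have "(f x - F i x)\<^sup>2 \<le> 2 * (f x)\<^sup>2 + 2 * (w x)\<^sup>2"
        using zero_le_power2[of "f x + F i x"] by linarith
      then show "norm ((f x - F i x)\<^sup>2) \<le> 2 * (f x)\<^sup>2 + 2 * (w x)\<^sup>2" by simp
    qed
  qed simp
  then have "\<forall>\<^sub>F i in sequentially. (LINT x|sphere_measure. (f x - F i x)\<^sup>2) < e"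
    using e by (intro order_tendstoD(2)[where y = "LINT x::'a|sphere_measure. 0"]) auto
  then obtain i where "(LINT x|sphere_measure. (f x - F i x)\<^sup>2) < e"
    by (auto simp: eventually_sequentially)
  with F show "\<exists>g. poly_approximable g \<and> (LINT x|sphere_measure. (f x - g x)\<^sup>2) < e" by blast
qed

lemma poly_approximable_continuous:
  fixes f :: "'a::euclidean_space \<Rightarrow> real"
  assumes f: "continuous_on (sphere 0 1) f"
  shows "poly_approximable f"
proof -
  have L2: "f \<in> sphere_L2" by (rule continuous_sphere_L2[OF f])
  have "\<exists>p. real_polynomial_function p \<and> (\<forall>x\<in>sphere 0 1. \<bar>f x - p x\<bar> < 1 / real (Suc i))" for i
  proof -
    have "0 < 1 / real (Suc i)" by simp
    from Stone_Weierstrass_real_polynomial_function[OF compact_sphere f this] show ?thesis by metis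
  qed
  then have "\<forall>i. \<exists>p. real_polynomial_function p \<and> (\<forall>x\<in>sphere 0 1. \<bar>f x - p x\<bar> < 1 / real (Suc i))" ..
  from choice[OF this] obtain p where
    "\<forall>i. real_polynomial_function (p i) \<and> (\<forall>x\<in>sphere 0 1. \<bar>f x - p i x\<bar> < 1 / real (Suc i))" ..
  then have p: "real_polynomial_function (p i)" "norm x = 1 \<Longrightarrow> \<bar>f x - p i x\<bar> < 1 / real (Suc i)" for i x
    by auto
  have fin: "1 / real (Suc i) \<le> 1" for i by simp
  show ?thesis
  proof (rule poly_approximable_limit[OF L2, of "\<lambda>x. \<bar>f x\<bar> + 1"])
    show "(\<lambda>x. \<bar>f x\<bar> + 1) \<in> sphere_L2"
      by (intro continuous_sphere_L2 continuous_intros f)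
    show "poly_approximable (p i)" for i using p(1) by (rule poly_approximable_polynomial)
    fix x :: 'a assume x: "norm x = 1"
    have "(\<lambda>i. 1 / real (Suc i)) \<longlonglongrightarrow> 0" using LIMSEQ_Suc[OF lim_1_over_n[where 'a=real]] by simp
    then show "(\<lambda>i. p i x) \<longlonglongrightarrow> f x"
      by (rule LIM_zero_cancel[OF Lim_null_comparison[rotated]])
         (use p(2)[OF x] in \<open>auto intro!: always_eventually less_imp_le simp: abs_minus_commute\<close>)
    show "\<bar>p i x\<bar> \<le> \<bar>\<bar>f x\<bar> + 1\<bar>" for i
      using p(2)[OF x, of i] fin[of i] by linarith
  qed
qed

text \<open>
  The sets whose indicators can be approximated contain the closed sets, by Urysohn functions built from
  the distance, and form a Dynkin system; closed sets are stable under intersection and generate the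
  Borel sets.
\<close>

lemma poly_approximable_indicator:
  fixes A :: "'a::euclidean_space set"
  assumes "A \<in> sets borel"
  shows "poly_approximable (indicator A :: 'a \<Rightarrow> real)"
proof -
  have indL2: "(indicator A :: 'a \<Rightarrow> real) \<in> sphere_L2" if A: "A \<in> sets borel" for A
  proof -
    have "(indicator A :: 'a \<Rightarrow> real) \<in> borel_measurable sphere_measure"
      unfolding measurable_cong_sets[OF sets_sphere_measure refl]
      using A by (intro measurable_restrict_space1) simp
    moreover from this have "integrable sphere_measure (indicator A :: 'a \<Rightarrow> real)"
      by (intro sphere.integrable_const_bound[of _ 1]) (auto simp: indicator_def)
    moreover have "(\<lambda>x::'a. (indicator A x :: real)\<^sup>2) = indicator A"
      by (auto simp: indicator_def)
    ultimately show ?thesis by (simp add: sphere_L2_def)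
  qed
  have one: "poly_approximable (\<lambda>x::'a. 1)" by (intro poly_approximable_polynomial real_polynomial_function.intros(2))
  have "A \<in> sigma_sets UNIV (Collect closed)" using assms by (simp add: borel_eq_closed sets_measure_of_conv)
  then show ?thesis
  proof (induction rule: sigma_sets_induct_disjoint[rotated 2, consumes 1, case_names basic empty compl union])
    case (basic C)
    then have C: "closed C" by simp
    show ?case
    proof (cases "C = {}")
      case True
      then show ?thesis by (simp add: poly_approximable_polynomial real_polynomial_function.intros(2) indicator_def[abs_def])
    next
      case False
      let ?F = "\<lambda>i x. max 0 (1 - real i * infdist x C)"
      show ?thesis
      proof (rule poly_approximable_limit[of _ "\<lambda>x. 1" ?F])
        show "indicator C \<in> sphere_L2" by (intro indL2) (use C in auto)
        show "(\<lambda>x::'a. 1) \<in> sphere_L2" by (intro continuous_sphere_L2 continuous_intros)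
        show "poly_approximable (?F i)" for i
          by (intro poly_approximable_continuous continuous_intros)
        fix x :: 'a
        show "\<bar>?F i x\<bar> \<le> \<bar>1\<bar>" for i using infdist_nonneg[of x C] by simp
        show "(\<lambda>i. ?F i x) \<longlonglongrightarrow> indicator C x"
        proof (cases "x \<in> C")
          case True
          then show ?thesis by (simp add: infdist_zero)
        next
          case x: False
          then have pos: "infdist x C > 0"
            using C False in_closed_iff_infdist_zero[of C x] infdist_nonneg[of x C] by force
          obtain N :: nat where N: "real N * infdist x C > 1"
            using reals_Archimedean3[OF pos] by blast
          have "?F i x = 0" if "i \<ge> N" for i
          proof -
            have "real N * infdist x C \<le> real i * infdist x C"
              using that pos by (intro mult_right_mono) auto
            then have "1 - real i * infdist x C \<le> 0" using N by linarith
            then show ?thesis by (rule max_absorb1)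
          qed
          then have "\<forall>\<^sub>F i in sequentially. ?F i x = indicator C x"
            using x by (intro eventually_sequentiallyI[of N]) simp
          then show ?thesis by (rule tendsto_eventually)
        qed
      qed
    qed
  next
    case empty
    then show ?case by (simp add: poly_approximable_polynomial real_polynomial_function.intros(2) indicator_def[abs_def])
  next
    case (compl A)
    have "(indicator (UNIV - A) :: 'a \<Rightarrow> real) = (\<lambda>x. 1 * 1 + (-1) * indicator A x)"
      by (auto simp: indicator_def)
    then show ?case using poly_approximable_lincomb[OF one compl.IH, of 1 "-1"] by simp
  next
    case (union A)
    have Ab: "A i \<in> sets borel" for i
      using union(2) by (auto simp: borel_eq_closed sets_measure_of_conv)
    show ?case
    proof (rule poly_approximable_limit[of _ "\<lambda>x. 1" "\<lambda>n x. indicator (\<Union>i<n. A i) x"])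
      show "indicator (\<Union> (range A)) \<in> sphere_L2" using Ab by (intro indL2) auto
      show "(\<lambda>x::'a. 1) \<in> sphere_L2" by (intro continuous_sphere_L2 continuous_intros)
      show "poly_approximable (\<lambda>x. indicator (\<Union>i<n. A i) x :: real)" for n
      proof -
        have "disjoint_family_on A {..<n}" using union(1) by (auto simp: disjoint_family_on_def)
        then have "(\<lambda>x. indicator (\<Union>i<n. A i) x :: real) = (\<lambda>x. \<Sum>i<n. indicator (A i) x)"
          by (auto simp: indicator_UN_disjoint)
        then show ?thesis using union(3) by (simp add: poly_approximable_sum)
      qed
      show "(\<lambda>n. indicator (\<Union>i<n. A i) x :: real) \<longlonglongrightarrow> indicator (\<Union> (range A)) x" for x
        by (rule LIMSEQ_indicator_UN)
    qed (simp add: indicator_def)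
  qed (auto simp: Int_stable_def)
qed

text \<open>
  Approximate by simple functions dominated by \<open>2 |f|\<close>, then each of their level sets by polynomials.
\<close>

theorem polynomials_dense_L2:
  fixes f :: "'a::euclidean_space \<Rightarrow> real"
  assumes f: "f \<in> sphere_L2"
  shows "poly_approximable f"
proof -
  obtain F where F: "\<And>i. simple_function sphere_measure (F i)"
    "\<And>x. x \<in> space sphere_measure \<Longrightarrow> (\<lambda>i. F i x) \<longlonglongrightarrow> f x"
    "\<And>i x. x \<in> space sphere_measure \<Longrightarrow> dist (F i x) 0 \<le> 2 * dist (f x) 0"
    using borel_measurable_implies_sequence_metric[OF sphere_L2_D(1)[OF f], of 0] by blast
  show ?thesis
  proof (rule poly_approximable_limit[OF f sphere_L2_scale[OF f, of 2], of F])
    show "poly_approximable (F i)" for i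
    proof (rule poly_approximable_cong)
      let ?I = "F i ` space sphere_measure"
      let ?S = "\<lambda>y. F i -` {y} \<inter> space sphere_measure"
      have "?S y \<in> sets borel" for y
        using simple_functionD(2)[OF F(1)[of i], of "{y}"] by (simp add: sets_sphere_measure_iff)
      then have "poly_approximable (\<lambda>x. y * indicator (?S y) x + 0 * indicator (?S y) x)" for y
        by (intro poly_approximable_lincomb poly_approximable_indicator)
      then have "poly_approximable (\<lambda>x. indicator (?S y) x * y)" for y
        by (simp add: mult.commute)
      then show "poly_approximable (\<lambda>x. \<Sum>y\<in>?I. indicator (?S y) x * y)"
        using simple_functionD(1)[OF F(1)] by (intro poly_approximable_sum)
      fix x :: 'a assume "norm x = 1"
      then show "(\<Sum>y\<in>?I. indicator (?S y) x * y) = F i x"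
        by (intro simple_function_indicator_representation_banach[OF F(1)[of i], of x, unfolded real_scaleR_def, symmetric]) simp
    qed
  qed (use F in \<open>auto simp: dist_norm abs_mult\<close>)
qed

section \<open>Duality\<close>

lemma integrable_sphere_continuous_mult:
  fixes u w :: "'a::euclidean_space \<Rightarrow> real"
  assumes w: "continuous_on (sphere 0 1) w" and u: "integrable sphere_measure u"
  shows "integrable sphere_measure (\<lambda>x. w x * u x)"
proof -
  have "bounded (w ` sphere 0 1)"
    by (intro compact_imp_bounded compact_continuous_image w) auto
  then obtain B where "\<forall>y\<in>w ` sphere 0 1. norm y \<le> B" unfolding bounded_iff by blast
  then have B: "\<bar>w x\<bar> \<le> B" if "norm x = 1" for x using that by auto
  show ?thesis
  proof (rule Bochner_Integration.integrable_bound)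
    show "integrable sphere_measure (\<lambda>x. B * \<bar>u x\<bar>)" using u by simp
    show "(\<lambda>x. w x * u x) \<in> borel_measurable sphere_measure"
      using borel_measurable_sphere_continuous[OF w] u by (intro borel_measurable_times) auto
    show "AE x in sphere_measure. norm (w x * u x) \<le> norm (B * \<bar>u x\<bar>)"
    proof (rule AE_I2)
      fix x :: 'a assume "x \<in> space sphere_measure"
      then have x: "norm x = 1" by simp
      have "\<bar>w x\<bar> * \<bar>u x\<bar> \<le> B * \<bar>u x\<bar>" by (intro mult_right_mono B x) simp
      also have "\<dots> \<le> \<bar>B * \<bar>u x\<bar>\<bar>" by (rule abs_ge_self)
      finally show "norm (w x * u x) \<le> norm (B * \<bar>u x\<bar>)" by (simp add: abs_mult)
    qed
  qed
qed

lemma sphere_dist_sq: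
  fixes f g :: "'a::euclidean_space \<Rightarrow> real"
  assumes "f \<in> sphere_L2" "g \<in> sphere_L2"
  shows "(LINT x|sphere_measure. (f x - g x)\<^sup>2) = sphere_inner f f - 2 * sphere_inner f g + sphere_inner g g"
proof -
  have "(LINT x|sphere_measure. (f x - g x)\<^sup>2) = (LINT x|sphere_measure. f x * f x - 2 * (f x * g x) + g x * g x)"
    by (rule integral_sphere_cong) (simp add: power2_eq_square algebra_simps)
  then show ?thesis
    using sphere_L2_mult_integrable[OF assms] sphere_L2_mult_integrable[OF assms(1) assms(1)]
      sphere_L2_mult_integrable[OF assms(2) assms(2)]
    by (simp add: sphere_inner_def)
qed

lemma green_harmonic_sum:
  fixes Y :: "nat \<Rightarrow> 'a::euclidean_space \<Rightarrow> real"
  assumes a: "real_polynomial_function a" and I: "finite I" and Y: "\<And>k. k \<in> I \<Longrightarrow> Y k \<in> harmonic_polys k"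
  shows "(LINT x|sphere_measure. tangential a (\<lambda>x. \<Sum>k\<in>I. c k * Y k x) x)
    = (\<Sum>k\<in>I. c k * (real k * (real k + real DIM('a) - 2) * sphere_inner a (Y k)))"
  using I Y
proof (induction I rule: finite_induct)
  case empty
  show ?case by (simp add: tangential_def grad_const)
next
  case (insert k I)
  let ?q = "\<lambda>x. \<Sum>k\<in>I. c k * Y k x"
  have Yk: "real_polynomial_function (Y k)" using insert.prems harmonic_polys_polynomial by blast
  have cY: "real_polynomial_function (\<lambda>x. c k * Y k x)" using Yk by (intro real_polynomial_function.intros(2-))
  have q: "real_polynomial_function ?q"
    using insert.prems harmonic_polys_polynomial
    by (intro real_polynomial_function_sum real_polynomial_function.intros(2-) insert.hyps) blast
  have "tangential a (\<lambda>x. c k * Y k x + ?q x) x = c k * tangential a (Y k) x + tangential a ?q x" for x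
    by (simp add: tangential_def grad_add[OF cY q] grad_scale[OF Yk] inner_add_left inner_add_right algebra_simps)
  then have "(LINT x|sphere_measure. tangential a (\<lambda>x. \<Sum>k\<in>insert k I. c k * Y k x) x)
    = (LINT x|sphere_measure. c k * tangential a (Y k) x + tangential a ?q x)"
    using insert.hyps by simp
  also have "\<dots> = c k * (LINT x|sphere_measure. tangential a (Y k) x) + (LINT x|sphere_measure. tangential a ?q x)"
  proof -
    have "integrable sphere_measure (tangential a (Y k))" "integrable sphere_measure (tangential a ?q)"
      by (intro integrable_sphere_continuous continuous_on_tangential a Yk q)+
    then show ?thesis by simp
  qed
  finally show ?case
    using insert by (simp add: green_harmonic[OF _ a] sphere_inner_def)
qed

text \<open>
  The duality step, for a single positive weight: \<open>h\<close> is the partial sum of the expansion of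
  \<open>(- \<Delta>\<^sub>0)\<^sup>-\<^sup>1\<^sup>/\<^sup>2 f\<close>, and \<open>mu k\<close> is the inverse square root of the eigenvalue \<open>lam k\<close>.
\<close>

lemma partial_sum_bound:
  fixes g :: "'a::euclidean_space \<Rightarrow> real" and Y :: "nat \<Rightarrow> 'a \<Rightarrow> real"
  assumes d: "DIM('a) \<ge> 4" and g: "g \<in> sphere_L2" and e: "norm e = 1" and s: "s > 0"
    and Y: "\<And>k. Y k \<in> harmonic_polys k"
    and gY: "\<And>k. k \<ge> 1 \<Longrightarrow>
      sphere_inner g (Y k) = (real k * (real k + real DIM('a) - 2)) powr (1/2) * sphere_inner (Y k) (Y k)"
  shows "(\<Sum>k\<in>{1..N}. sphere_inner (Y k) (Y k))
    \<le> (2 * DIM('a) + 4) * (LINT x|sphere_measure. (1 + s - x \<bullet> e) * (g x)\<^sup>2)"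
proof -
  define lam where "lam k = real k * (real k + real DIM('a) - 2)" for k
  define mu where "mu k = lam k powr (- 1/2)" for k
  define n2 where "n2 k = sphere_inner (Y k) (Y k)" for k
  define E where "E = (\<Sum>k\<in>{1..N}. n2 k)"
  define h where "h x = (\<Sum>k\<in>{1..N}. mu k * Y k x)" for x
  define C where "C = real (2 * DIM('a) + 4)"
  have C: "C > 0" by (simp add: C_def)
  have lam1: "lam k \<ge> 1" if "k \<ge> 1" for k
  proof -
    have "1 * 1 \<le> real k * (real k + real DIM('a) - 2)" using that d by (intro mult_mono) auto
    then show ?thesis by (simp add: lam_def)
  qed
  have mul: "mu k * lam k powr (1/2) = 1" "mu k * mu k * lam k = 1" "mu k * mu k \<le> 1" if "k \<ge> 1" for k
  proof -
    have p: "lam k > 0" using lam1[OF that] by simp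
    show "mu k * lam k powr (1/2) = 1" using p by (simp add: mu_def flip: powr_add)
    have mm: "mu k * mu k = 1 / lam k"
      using p by (simp add: mu_def powr_minus_divide flip: powr_add)
    then show "mu k * mu k * lam k = 1" "mu k * mu k \<le> 1" using p lam1[OF that] by simp_all
  qed
  have Yp: "real_polynomial_function (Y k)" for k using Y harmonic_polys_polynomial by blast
  have hp: "real_polynomial_function h"
    unfolding h_def[abs_def] by (intro real_polynomial_function_sum real_polynomial_function.intros(2-) Yp) simp
  have inner_h: "sphere_inner u h = (\<Sum>k\<in>{1..N}. mu k * sphere_inner u (Y k))" if "u \<in> sphere_L2" for u
    unfolding h_def[abs_def]
    by (subst sphere_inner_sum_right) (auto intro: sphere_L2_scale polynomial_sphere_L2 Yp that simp: sphere_inner_scale_right)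
  have hY: "sphere_inner h (Y k) = mu k * n2 k" if "k \<in> {1..N}" for k
  proof -
    have "sphere_inner h (Y k) = sphere_inner (Y k) h" by (rule sphere_inner_commute)
    also have "\<dots> = (\<Sum>j\<in>{1..N}. mu j * sphere_inner (Y k) (Y j))"
      by (rule inner_h[OF polynomial_sphere_L2[OF Yp]])
    also have "\<dots> = (\<Sum>j\<in>{1..N}. if j = k then mu k * n2 k else 0)"
      using d by (intro sum.cong) (auto simp: n2_def harmonic_polys_inner_orthogonal[OF Y Y])
    finally show ?thesis using that by simp
  qed
  have "sphere_inner g h = (\<Sum>k\<in>{1..N}. (mu k * lam k powr (1/2)) * n2 k)"
    by (simp add: inner_h[OF g] gY lam_def n2_def mult.assoc)
  also have "\<dots> = E" unfolding E_def by (intro sum.cong) (auto simp: mul)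
  finally have gh: "sphere_inner g h = E" .
  have hh: "sphere_inner h h \<le> E"
  proof -
    have "sphere_inner h h = (\<Sum>k\<in>{1..N}. (mu k * mu k) * n2 k)"
      by (simp add: inner_h[OF polynomial_sphere_L2[OF hp]] hY mult.assoc)
    also have "\<dots> \<le> E" unfolding E_def
      using mul(3) by (intro sum_mono mult_left_le_one_le) (auto simp: n2_def sphere_inner_self_nonneg)
    finally show ?thesis .
  qed
  have "(LINT x|sphere_measure. tangential h (\<lambda>x. \<Sum>k\<in>{1..N}. mu k * Y k x) x)
      = (\<Sum>k\<in>{1..N}. mu k * (lam k * sphere_inner h (Y k)))"
    unfolding lam_def by (rule green_harmonic_sum[OF hp _ Y]) simp
  also have "\<dots> = (\<Sum>k\<in>{1..N}. (mu k * mu k * lam k) * n2 k)"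
    by (intro sum.cong) (auto simp: hY)
  also have "\<dots> = E" unfolding E_def by (intro sum.cong) (auto simp: mul)
  finally have Th: "(LINT x|sphere_measure. tangential h h x) = E"
    by (simp add: h_def[abs_def])
  let ?w = "\<lambda>x. 1 + s - x \<bullet> e"
  have wpos: "?w x > 0" if "norm x = 1" for x
    using Cauchy_Schwarz_ineq2[of x e] that e s by simp
  have "(LINT x|sphere_measure. (h x)\<^sup>2 / ?w x)
      \<le> 2 * ((DIM('a) - 2) * (LINT x|sphere_measure. (h x)\<^sup>2) + 4 * (LINT x|sphere_measure. tangential h h x))"
    by (rule sphere_hardy[OF hp e s d])
  also have "(LINT x|sphere_measure. (h x)\<^sup>2) = sphere_inner h h"
    by (simp add: sphere_inner_def power2_eq_square)
  also have "2 * ((DIM('a) - 2) * sphere_inner h h + 4 * (LINT x|sphere_measure. tangential h h x))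
      \<le> 2 * ((DIM('a) - 2) * E + 4 * E)"
    unfolding Th using mult_left_mono[OF hh, of "real (DIM('a) - 2)"] by simp
  also have "\<dots> = C * E" using d by (simp add: C_def of_nat_diff algebra_simps)
  finally have hardy: "(LINT x|sphere_measure. (h x)\<^sup>2 / ?w x) \<le> C * E" .
  have int1: "integrable sphere_measure (\<lambda>x. ?w x * (g x)\<^sup>2)"
    by (intro integrable_sphere_continuous_mult continuous_intros sphere_L2_D[OF g])
  have int2: "integrable sphere_measure (\<lambda>x. (h x)\<^sup>2 / ?w x)"
    by (intro integrable_sphere_continuous continuous_intros continuous_on_polynomial[OF hp]) (use wpos in force)
  have "E = (LINT x|sphere_measure. g x * h x)" using gh by (simp add: sphere_inner_def)
  also have "\<dots> \<le> (LINT x|sphere_measure. C / 2 * (?w x * (g x)\<^sup>2) + 1 / (2 * C) * ((h x)\<^sup>2 / ?w x))"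
  proof (rule integral_sphere_mono)
    fix x :: 'a assume "norm x = 1"
    then have w: "C * ?w x > 0" using wpos C by simp
    have amgm: "a * b \<le> v * a\<^sup>2 / 2 + b\<^sup>2 / (2 * v)" if "v > 0" for a b v :: real
    proof -
      have "v * a\<^sup>2 / 2 + b\<^sup>2 / (2 * v) - a * b = (v * a - b)\<^sup>2 / (2 * v)"
        using that by (simp add: power2_eq_square field_simps)
      also have "\<dots> \<ge> 0" using that by simp
      finally show ?thesis by simp
    qed
    show "g x * h x \<le> C / 2 * (?w x * (g x)\<^sup>2) + 1 / (2 * C) * ((h x)\<^sup>2 / ?w x)"
      using amgm[OF w, of "g x" "h x"] by (simp add: mult_ac)
  next
    have "integrable sphere_measure (\<lambda>x. a * F x + b * G x)"
      if "integrable sphere_measure F" "integrable sphere_measure G" for F G :: "'a \<Rightarrow> real" and a b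
      using that by simp
    from this[OF int1 int2]
    show "integrable sphere_measure (\<lambda>x. C / 2 * (?w x * (g x)\<^sup>2) + 1 / (2 * C) * ((h x)\<^sup>2 / ?w x))" .
  qed (rule sphere_L2_mult_integrable[OF g polynomial_sphere_L2[OF hp]])
  also have "\<dots> = C / 2 * (LINT x|sphere_measure. ?w x * (g x)\<^sup>2) + 1 / (2 * C) * (LINT x|sphere_measure. (h x)\<^sup>2 / ?w x)"
  proof -
    have "(LINT x|sphere_measure. a * F x + b * G x) = a * (LINT x|sphere_measure. F x) + b * (LINT x|sphere_measure. G x)"
      if "integrable sphere_measure F" "integrable sphere_measure G" for F G :: "'a \<Rightarrow> real" and a b
      using that by simp
    from this[OF int1 int2] show ?thesis .
  qed
  also have "\<dots> \<le> C / 2 * (LINT x|sphere_measure. ?w x * (g x)\<^sup>2) + 1 / (2 * C) * (C * E)"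
    using hardy C by (intro add_left_mono mult_left_mono) auto
  also have "\<dots> = C / 2 * (LINT x|sphere_measure. ?w x * (g x)\<^sup>2) + E / 2" using C by simp
  finally show ?thesis by (simp add: E_def n2_def C_def)
qed

text \<open>
  For a polynomial \<open>p\<close> close to \<open>f\<close>, of degree at most \<open>N\<close> say, the partial sum \<open>F\<close> of the expansion of
  \<open>f\<close> up to \<open>N\<close> has the same inner product with \<open>p\<close> as \<open>f\<close>. Therefore
  \<open>\<parallel>f\<parallel>\<^sup>2 - \<parallel>F\<parallel>\<^sup>2 = \<parallel>f - p\<parallel>\<^sup>2 - \<parallel>F - p\<parallel>\<^sup>2\<close> is small, which reduces the claim to partial sums.
\<close>

theorem weighted_inequality:
  fixes f g :: "'a::euclidean_space \<Rightarrow> real"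
  assumes d: "DIM('a) \<ge> 4" and f: "f \<in> sphere_L2" and fg: "is_fractional_laplacian (1/2) f g"
    and mean: "(LINT x|sphere_measure. f x) = 0" and e: "norm e = 1"
  shows "(LINT x|sphere_measure. (f x)\<^sup>2) \<le> (2 * DIM('a) + 4) * (LINT x|sphere_measure. (1 - x \<bullet> e) * (g x)\<^sup>2)"
proof -
  have d2: "DIM('a) \<ge> 2" using d by simp
  have g: "g \<in> sphere_L2" using fg by (simp add: is_fractional_laplacian_def)
  have "\<forall>k. \<exists>Y. Y \<in> harmonic_polys k \<and> (\<forall>x\<in>sphere 0 1. proj k f x = Y x) \<and> (\<forall>Z\<in>harmonic_polys k. sphere_inner f Z = sphere_inner Y Z)"
    using proj_characterization[OF f d2] by blast
  from choice[OF this] obtain Y where "\<forall>k. Y k \<in> harmonic_polys k \<and> (\<forall>x\<in>sphere 0 1. proj k f x = Y k x) \<and>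
      (\<forall>Z\<in>harmonic_polys k. sphere_inner f Z = sphere_inner (Y k) Z)" ..
  then have Y: "Y k \<in> harmonic_polys k" "norm x = 1 \<Longrightarrow> proj k f x = Y k x"
    "Z \<in> harmonic_polys k \<Longrightarrow> sphere_inner f Z = sphere_inner (Y k) Z" for k x Z by auto
  have YL2: "Y k \<in> sphere_L2" for k by (rule harmonic_polys_L2[OF Y(1)])
  have gY: "sphere_inner g (Y k) = (real k * (real k + real DIM('a) - 2)) powr (1/2) * sphere_inner (Y k) (Y k)"
    if k: "k \<ge> 1" for k
  proof -
    obtain X where X: "X \<in> harmonic_polys k" "\<forall>x\<in>sphere 0 1. proj k g x = X x" "\<forall>Z\<in>harmonic_polys k. sphere_inner g Z = sphere_inner X Z"
      using proj_characterization[OF g d2] by blast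
    let ?l = "(real k * (real k + real DIM('a) - 2)) powr (1/2)"
    have "X x = ?l * Y k x" if "norm x = 1" for x
    proof -
      have "proj k g x = ?l * proj k f x"
        using fg k that by (simp add: is_fractional_laplacian_def)
      moreover have "proj k g x = X x" using X(2) that by simp
      ultimately show ?thesis using Y(2)[OF that, of k] by simp
    qed
    then have "sphere_inner X (Y k) = sphere_inner (\<lambda>x. ?l * Y k x) (Y k)"
      by (intro sphere_inner_cong) auto
    then show ?thesis using X(3) Y(1) by (simp add: sphere_inner_scale_left)
  qed
  have Y0: "sphere_inner (Y 0) (Y 0) = 0"
  proof -
    have "sphere_inner (Y 0) (Y 0) = sphere_inner f (Y 0)" by (rule Y(3)[OF Y(1), symmetric])
    also have "\<dots> = sphere_inner f (\<lambda>x. Y 0 0 * 1)"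
      by (rule sphere_inner_cong) (simp_all only: mult_1_right, rule homogeneous_polys_0_const[OF harmonic_polys_homogeneous_polys[OF Y(1)]])
    also have "\<dots> = 0" unfolding sphere_inner_scale_right using mean by (simp add: sphere_inner_def)
    finally show ?thesis .
  qed
  define C where "C = real (2 * DIM('a) + 4)"
  define A where "A = (LINT x|sphere_measure. (1 - x \<bullet> e) * (g x)\<^sup>2)"
  define B where "B = (LINT x|sphere_measure. (g x)\<^sup>2)"
  have C: "C > 0" by (simp add: C_def)
  have B: "B \<ge> 0" unfolding B_def by (rule integral_sphere_nonneg) simp
  have EN: "(\<Sum>k\<in>{1..N}. sphere_inner (Y k) (Y k)) \<le> C * A" for N
  proof (rule field_le_epsilon)
    fix \<epsilon> :: real assume eps: "\<epsilon> > 0"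
    \<comment> \<open>The summand \<open>1\<close> covers the case that \<open>B\<close> vanishes.\<close>
    define s where "s = \<epsilon> / (C * (B + 1))"
    have s: "s > 0" using eps C B by (simp add: s_def)
    have "(\<Sum>k\<in>{1..N}. sphere_inner (Y k) (Y k)) \<le> C * (LINT x|sphere_measure. (1 + s - x \<bullet> e) * (g x)\<^sup>2)"
      unfolding C_def by (rule partial_sum_bound[OF d g e s Y(1) gY])
    also have "(LINT x|sphere_measure. (1 + s - x \<bullet> e) * (g x)\<^sup>2)
        = (LINT x|sphere_measure. (1 - x \<bullet> e) * (g x)\<^sup>2 + s * (g x)\<^sup>2)"
      by (rule integral_sphere_cong) (simp add: algebra_simps)
    also have "\<dots> = A + s * B"
    proof -
      have "integrable sphere_measure (\<lambda>x. (1 - x \<bullet> e) * (g x)\<^sup>2)"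
        by (intro integrable_sphere_continuous_mult continuous_intros sphere_L2_D[OF g])
      then show ?thesis using sphere_L2_D(2)[OF g] by (simp add: A_def B_def)
    qed
    also have "C * (A + s * B) \<le> C * A + \<epsilon>"
    proof -
      have "C * (s * B) \<le> C * (s * (B + 1))" using C s by (intro mult_left_mono) auto
      also have "\<dots> = \<epsilon>" using C B by (simp add: s_def)
      finally show ?thesis by (simp add: distrib_left)
    qed
    finally show "(\<Sum>k\<in>{1..N}. sphere_inner (Y k) (Y k)) \<le> C * A + \<epsilon>" .
  qed
  have "sphere_inner f f \<le> C * A"
  proof (rule field_le_epsilon)
    fix \<epsilon> :: real assume eps: "\<epsilon> > 0"
    obtain p where p: "real_polynomial_function p" "(LINT x|sphere_measure. (f x - p x)\<^sup>2) < \<epsilon>"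
      using polynomials_dense_L2[OF f] eps unfolding poly_approximable_def by blast
    obtain Z N where Z: "\<And>k. Z k \<in> harmonic_polys k" "\<And>x. norm x = 1 \<Longrightarrow> p x = (\<Sum>k\<le>N. Z k x)"
      using polynomial_sum_harmonic_polys[OF p(1)] by blast
    define F where "F x = (\<Sum>k\<le>N. Y k x)" for x
    have FL2: "F \<in> sphere_L2" unfolding F_def[abs_def] by (intro sphere_L2_sum YL2) simp
    have pL2: "p \<in> sphere_L2" by (rule polynomial_sphere_L2[OF p(1)])
    have FW: "sphere_inner F W = sphere_inner f W" if W: "W \<in> harmonic_polys k" and k: "k \<le> N" for W k
    proof -
      have "sphere_inner F W = sphere_inner W F" by (rule sphere_inner_commute)
      also have "\<dots> = (\<Sum>j\<le>N. sphere_inner W (Y j))"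
        unfolding F_def[abs_def] by (rule sphere_inner_sum_right[OF YL2 harmonic_polys_L2[OF W]])
      also have "\<dots> = (\<Sum>j\<le>N. if j = k then sphere_inner W (Y k) else 0)"
        using harmonic_polys_inner_orthogonal[OF W Y(1) _ d2] by (intro sum.cong) auto
      also have "\<dots> = sphere_inner W (Y k)" using k by simp
      finally show ?thesis using Y(3)[OF W] by (simp add: sphere_inner_commute)
    qed
    have Fp: "sphere_inner F p = sphere_inner f p"
    proof -
      have *: "sphere_inner u p = (\<Sum>k\<le>N. sphere_inner u (Z k))" if "u \<in> sphere_L2" for u
      proof -
        have "sphere_inner u p = sphere_inner u (\<lambda>x. \<Sum>k\<le>N. Z k x)"
          by (rule sphere_inner_cong) (auto simp: Z(2))
        then show ?thesis by (simp add: sphere_inner_sum_right[OF harmonic_polys_L2[OF Z(1)] that])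
      qed
      show ?thesis unfolding *[OF FL2] *[OF f] by (rule sum.cong) (auto intro: FW[OF Z(1)])
    qed
    have "sphere_inner F F = (\<Sum>k\<le>N. sphere_inner F (Y k))"
      by (subst (2) F_def[abs_def]) (rule sphere_inner_sum_right[OF YL2 FL2])
    also have "\<dots> = (\<Sum>k\<le>N. sphere_inner (Y k) (Y k))"
      by (intro sum.cong) (auto simp: FW[OF Y(1)] Y(3)[OF Y(1)])
    also have "\<dots> = sphere_inner (Y 0) (Y 0) + (\<Sum>k\<in>{1..N}. sphere_inner (Y k) (Y k))"
      by (simp add: atMost_atLeast0 sum.atLeast_Suc_atMost)
    also have "\<dots> \<le> C * A" using EN Y0 by simp
    finally have FF: "sphere_inner F F \<le> C * A" .
    have "0 \<le> (LINT x|sphere_measure. (F x - p x)\<^sup>2)" by (rule integral_sphere_nonneg) simp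
    then have "0 \<le> sphere_inner F F - 2 * sphere_inner f p + sphere_inner p p"
      unfolding sphere_dist_sq[OF FL2 pL2] Fp .
    moreover have "sphere_inner f f - 2 * sphere_inner f p + sphere_inner p p < \<epsilon>"
      using p(2) unfolding sphere_dist_sq[OF f pL2] .
    ultimately show "sphere_inner f f \<le> C * A + \<epsilon>" using FF by linarith
  qed
  then show ?thesis by (simp add: sphere_inner_def power2_eq_square C_def A_def)
qed

text \<open>
  The integral is an affine function of \<open>e\<close>, hence continuous on the compact sphere.
\<close>

lemma exists_minimal_direction:
  fixes g :: "'a::euclidean_space \<Rightarrow> real"
  assumes g: "g \<in> sphere_L2"
  shows "\<exists>e. is_arg_min (\<lambda>e. LINT x|sphere_measure. (1 - x \<bullet> e) * \<bar>g x\<bar>\<^sup>2) (\<lambda>e. e \<in> sphere 0 1) e"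
proof -
  let ?m = "\<lambda>b. LINT x|sphere_measure. (x \<bullet> b) * (g x)\<^sup>2"
  have int: "integrable sphere_measure (\<lambda>x. (x \<bullet> b) * (g x)\<^sup>2)" for b
    by (intro integrable_sphere_continuous_mult continuous_intros sphere_L2_D[OF g])
  have affine: "(LINT x|sphere_measure. (1 - x \<bullet> e) * \<bar>g x\<bar>\<^sup>2)
      = (LINT x|sphere_measure. (g x)\<^sup>2) - (\<Sum>b\<in>Basis. (e \<bullet> b) * ?m b)" for e
  proof -
    have "(LINT x|sphere_measure. (1 - x \<bullet> e) * \<bar>g x\<bar>\<^sup>2)
        = (LINT x|sphere_measure. (g x)\<^sup>2 - (\<Sum>b\<in>Basis. (e \<bullet> b) * ((x \<bullet> b) * (g x)\<^sup>2)))"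
      by (rule integral_sphere_cong)
         (simp add: euclidean_inner[of _ e] left_diff_distrib right_diff_distrib sum_distrib_left sum_distrib_right mult_ac)
    then show ?thesis using sphere_L2_D(2)[OF g] int by simp
  qed
  have "continuous_on (sphere 0 1) (\<lambda>e. LINT x|sphere_measure. (1 - x \<bullet> e) * \<bar>g x\<bar>\<^sup>2)"
    unfolding affine by (intro continuous_intros)
  moreover have "sphere (0::'a) 1 \<noteq> {}" using nonempty_Basis norm_Basis by force
  ultimately obtain e where "e \<in> sphere 0 1"
    "\<forall>y\<in>sphere 0 1. (LINT x|sphere_measure. (1 - x \<bullet> e) * \<bar>g x\<bar>\<^sup>2) \<le> (LINT x|sphere_measure. (1 - x \<bullet> y) * \<bar>g x\<bar>\<^sup>2)"
    using continuous_attains_inf[OF compact_sphere] by blast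
  then show ?thesis unfolding is_arg_min_def by (intro exI[of _ e]) (auto simp: not_less)
qed

theorem theorem3p3:
  assumes "CARD('n::finite) \<ge> 4"
  shows "\<exists>c::real. c > 0 \<and>
    (\<forall>f \<in> (sobolev_W2 1 :: (real^'n \<Rightarrow> real) set).
       (LINT x|sphere_measure. f x) = 0 \<longrightarrow>
       (\<exists>e. is_arg_min
              (\<lambda>e. LINT x|sphere_measure. (1 - x \<bullet> e) * \<bar>fractional_laplacian (1/2) f x\<bar>\<^sup>2)
              (\<lambda>e. e \<in> sphere 0 1) e \<and>
            (LINT x|sphere_measure. \<bar>f x\<bar>\<^sup>2)
              \<le> c * (LINT x|sphere_measure. (1 - x \<bullet> e) * \<bar>fractional_laplacian (1/2) f x\<bar>\<^sup>2)))"
proof (intro exI[of _ "real (2 * DIM(real^'n) + 4)"] conjI ballI impI)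
  show "0 < real (2 * DIM(real^'n) + 4)" by simp
  fix f :: "real^'n \<Rightarrow> real"
  assume fW: "f \<in> sobolev_W2 1" and mean: "(LINT x|sphere_measure. f x) = 0"
  let ?g = "fractional_laplacian (1/2) f"
  have f: "f \<in> sphere_L2" and ex: "\<exists>g. is_fractional_laplacian (1/2) f g"
    using fW by (auto simp: sobolev_W2_def)
  have fg: "is_fractional_laplacian (1/2) f ?g"
    unfolding fractional_laplacian_def by (rule someI_ex[OF ex])
  then have g: "?g \<in> sphere_L2" by (simp add: is_fractional_laplacian_def)
  obtain e where e: "is_arg_min (\<lambda>e. LINT x|sphere_measure. (1 - x \<bullet> e) * \<bar>?g x\<bar>\<^sup>2) (\<lambda>e. e \<in> sphere 0 1) e"
    using exists_minimal_direction[OF g] by blast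
  then have ne: "norm e = 1" by (simp add: is_arg_min_def)
  have d: "DIM(real^'n) \<ge> 4" using assms by simp
  have "(LINT x|sphere_measure. \<bar>f x\<bar>\<^sup>2)
      \<le> real (2 * DIM(real^'n) + 4) * (LINT x|sphere_measure. (1 - x \<bullet> e) * \<bar>?g x\<bar>\<^sup>2)"
    using weighted_inequality[OF d f fg mean ne] by simp
  with e show "\<exists>e. is_arg_min (\<lambda>e. LINT x|sphere_measure. (1 - x \<bullet> e) * \<bar>?g x\<bar>\<^sup>2) (\<lambda>e. e \<in> sphere 0 1) e \<and>
      (LINT x|sphere_measure. \<bar>f x\<bar>\<^sup>2)
        \<le> real (2 * DIM(real^'n) + 4) * (LINT x|sphere_measure. (1 - x \<bullet> e) * \<bar>?g x\<bar>\<^sup>2)" by blast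
qed

end
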